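(* Let $\alpha>0$. A lattice $\Lambda\subseteq\mathbb{C}$ is a Liouville set for $\mathcal{F}_\alpha(\mathbb{C})$ if and only if $s(\Lambda)<\frac{\pi}{\alpha}$.
   Context: For $\alpha>0$, $\mathcal{F}_\alpha(\mathbb{C})$ is the Fock space of entire functions $F:\mathbb{C}\to\mathbb{C}$ with $\int_{\mathbb{C}}|F(z)|^2e^{-\alpha|z|^2}\,dA(z)<\infty$, where $dA$ is Lebesgue area measure. A lattice with periods $\omega_1,\omega_2\in\mathbb{C}\setminus\{0\}$, where $\operatorname{Im}\frac{\omega_2}{\omega_1}>0$, is the set $\Lambda=\{m\omega_1+n\omega_2: m,n\in\mathbb{Z}\}$. The area of its period parallelogram is $s(\Lambda)=\operatorname{Im}(\overline{\omega_1}\omega_2)>0$. A set $\Lambda\subseteq\mathbb{C}$ is a Liouville set for $\mathcal{F}_\alpha(\mathbb{C})$ if every $F\in\mathcal{F}_\alpha(\mathbb{C})$ that is bounded on $\Lambda$ is a constant function. *)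

theory Defs
  imports "HOL-Analysis.Analysis"
begin

definition Fock_space :: "real \<Rightarrow> (complex \<Rightarrow> complex) set" where
  "Fock_space \<alpha> = {F. F holomorphic_on UNIV \<and>
     integrable lborel (\<lambda>z. (cmod (F z))\<^sup>2 * exp (- \<alpha> * (cmod z)\<^sup>2))}"

definition lattice_periods :: "complex \<Rightarrow> complex \<Rightarrow> bool" where
  "lattice_periods \<omega>1 \<omega>2 \<longleftrightarrow> \<omega>1 \<noteq> 0 \<and> \<omega>2 \<noteq> 0 \<and> Im (\<omega>2 / \<omega>1) > 0"

definition period_lattice :: "complex \<Rightarrow> complex \<Rightarrow> complex set" where
  "period_lattice \<omega>1 \<omega>2 = {of_int m * \<omega>1 + of_int n * \<omega>2 | m n :: int. True}"

(* The area s is a function of the chosen periods; it is the same for all admissible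
   period pairs that generate the same lattice. *)
definition lattice_area :: "complex \<Rightarrow> complex \<Rightarrow> real" where
  "lattice_area \<omega>1 \<omega>2 = Im (cnj \<omega>1 * \<omega>2)"

definition Liouville_set :: "real \<Rightarrow> complex set \<Rightarrow> bool" where
  "Liouville_set \<alpha> \<Lambda> \<longleftrightarrow>
     (\<forall>F \<in> Fock_space \<alpha>. bounded (F ` \<Lambda>) \<longrightarrow> F constant_on UNIV)"

end

theory Submission
  imports Defs "HOL-Complex_Analysis.Complex_Analysis" "HOL-Real_Asymp.Real_Asymp"
begin

text \<open>
  Put \<open>\<beta> = \<pi> / s(\<Lambda>)\<close>, so that the claim reads: \<open>\<Lambda>\<close> is a Liouville set iff \<open>\<alpha> < \<beta>\<close>. The number
  \<open>\<beta>\<close> is the least growth rate of nonzero entire functions that vanish on \<open>\<Lambda>\<close>: there is an entire \<open>\<sigma>\<close> whose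
  zeros are simple and are exactly the points of \<open>\<Lambda>\<close>, and for which \<open>\<bar>\<sigma> z\<bar> exp (- \<beta> \<bar>z\<bar>\<^sup>2 / 2)\<close> is
  \<open>\<Lambda>\<close>-periodic. It is a theta product in \<open>exp (2 \<pi> i z / \<omega>1)\<close> times the exponential of a quadratic
  polynomial; the product shows its zeros at once, and the period relation \<open>\<beta> s(\<Lambda>) = \<pi>\<close> is what
  makes one quadratic polynomial fit both periods (\<open>sigma_eq_0_iff\<close>, \<open>weighted_sigma_periodic\<close>).

  If \<open>\<beta> \<le> \<alpha>\<close>, the function \<open>\<sigma> z / (z (z - \<omega>1))\<close> is a counterexample. It vanishes on \<open>\<Lambda>\<close> except
  at \<open>0\<close> and \<open>\<omega>1\<close>, it is not constant, and its weighted modulus is \<open>O (1 / (1 + \<bar>z\<bar>\<^sup>2))\<close>, which is square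
  integrable on the plane. Dividing out two zeros is what makes the critical case \<open>\<alpha> = \<beta>\<close> work.

  If \<open>\<alpha> < \<beta>\<close>, functions in the Fock space grow more slowly than \<open>\<sigma>\<close> on the boundaries of large
  period parallelograms, so they are determined by their values on \<open>\<Lambda>\<close> through Lagrange
  interpolation. The cardinal functions of this interpolation are obtained from \<open>\<sigma> z / z\<close> by
  Weyl translations and are bounded by a multiple of
  \<open>exp (\<beta> \<bar>z\<bar>\<^sup>2 / 2) exp (- \<beta> \<bar>l\<bar>\<^sup>2 / 2)\<close>, which is summable over \<open>l\<close>. Hence a bound \<open>M\<close> of \<open>F\<close> on
  \<open>\<Lambda>\<close> gives \<open>\<bar>F\<bar> \<le> C M\<close> on the central period parallelogram with a constant \<open>C\<close> that depends only on the
  lattice (\<open>interpolation_estimate\<close>). The hypotheses on \<open>F\<close> are invariant under \<open>F \<mapsto> F (\<cdot> + l)\<close> for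
  \<open>l \<in> \<Lambda>\<close> provided that growth is measured by \<open>exp (a \<bar>z\<bar>\<^sup>2 / 2 + B \<bar>z\<bar>)\<close> with unspecified \<open>B\<close>. So
  the same \<open>C\<close> serves on every translate of the parallelogram; \<open>F\<close> is bounded and
  Liouville's theorem applies.

  In place of the residue theorem the interpolation step uses the maximum principle: a finite
  interpolation sum over the lattice points of a large parallelogram is subtracted from \<open>F\<close>, the difference is
  divisible by \<open>\<sigma>\<close> there, and the quotient is estimated on the boundary.
\<close>

section \<open>Growth of functions in the Fock space\<close>

text \<open>
  The area integral over a disc is compared with circle means by averaging over rotations about the
  centre. This avoids polar coordinates, at the price of rotation invariance of the Lebesgue measure
  on the complex plane, which is transported from the Euclidean plane of real vectors.
\<close>
lemma lborel_distr_orthogonal: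
  fixes T :: "real^2 \<Rightarrow> real^2"
  assumes T: "orthogonal_transformation T"
  shows "distr lborel borel T = lborel"
proof (rule lborel_eqI[symmetric])
  fix l v :: "real^2"
  assume lv: "\<And>b. b \<in> Basis \<Longrightarrow> l \<bullet> b \<le> v \<bullet> b"
  have T': "orthogonal_transformation (inv T)" "bij T"
    using T by (auto intro: orthogonal_transformation_inv orthogonal_transformation_bij)
  have "continuous_on UNIV T"
    using T by (intro linear_continuous_on linear_conv_bounded_linear[THEN iffD1] orthogonal_transformation_linear)
  then have meas: "T \<in> borel_measurable borel"
    by (rule borel_measurable_continuous_onI)
  have vim: "T -` box l v = inv T ` box l v"
    using bij_vimage_eq_inv_image[OF T'(2)] .
  have lm: "inv T ` box l v \<in> lmeasurable"
    by (intro measurable_orthogonal_image T' lmeasurable_box)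
  have sb: "T -` box l v \<in> sets borel"
    using measurable_sets[OF meas, of "box l v"] by simp
  have "emeasure (distr lborel borel T) (box l v) = emeasure lborel (T -` box l v)"
    using meas by (subst emeasure_distr) auto
  also have "\<dots> = emeasure lebesgue (inv T ` box l v)"
    using sb by (simp add: emeasure_completion vim)
  also have "\<dots> = ennreal (measure lebesgue (inv T ` box l v))"
    using lm by (simp add: emeasure_eq_measure2)
  also have "measure lebesgue (inv T ` box l v) = measure lebesgue (box l v)"
    by (intro measure_orthogonal_image T' lmeasurable_box)
  also have "\<dots> = (\<Prod>b\<in>Basis. (v - l) \<bullet> b)"
    using lv by (simp add: measure_completion measure_lborel_box_eq)
  finally show "emeasure (distr lborel borel T) (box l v) = ennreal (\<Prod>b\<in>Basis. (v - l) \<bullet> b)" .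
qed simp

definition vec_to_complex :: "real^2 \<Rightarrow> complex" where
  "vec_to_complex v = Complex (v $ 1) (v $ 2)"

lemma measurable_vec_to_complex [measurable]: "vec_to_complex \<in> borel_measurable borel"
  unfolding vec_to_complex_def complex_eq
  by (intro borel_measurable_continuous_onI continuous_intros)

lemma distr_vec_to_complex: "distr lborel borel vec_to_complex = lborel"
proof (rule lborel_eqI[symmetric])
  fix l v :: complex
  assume lv: "\<And>b. b \<in> Basis \<Longrightarrow> l \<bullet> b \<le> v \<bullet> b"
  have re_im: "Re l \<le> Re v" "Im l \<le> Im v"
    using lv[of 1] lv[of \<i>] by (simp_all add: Basis_complex_def)
  let ?w = "\<lambda>z::complex. (\<chi> i. if i = 1 then Re z else Im z) :: real^2"
  have "vec_to_complex -` box l v = box (?w l) (?w v)"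
    by (auto simp: vec_to_complex_def in_box_complex_iff mem_box_cart forall_2)
  then have "emeasure (distr lborel borel vec_to_complex) (box l v) = emeasure lborel (box (?w l) (?w v))"
    by (subst emeasure_distr) auto
  also have "\<dots> = ennreal (\<Prod>b\<in>Basis. (?w v - ?w l) \<bullet> b)"
    using re_im by (intro emeasure_lborel_box) (auto simp: Basis_vec_def inner_axis)
  also have "(\<Prod>b\<in>Basis. (?w v - ?w l) \<bullet> b) = (\<Prod>i\<in>UNIV. (?w v - ?w l) $ i)"
    unfolding Basis_vec_def
    by (subst prod.reindex_cong[where l = "\<lambda>i. axis i 1" and B = UNIV]) (auto simp: inj_on_def axis_eq_axis inner_axis)
  also have "\<dots> = (\<Prod>b\<in>Basis. (v - l) \<bullet> b)"
    by (simp add: UNIV_2 Basis_complex_def)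
  finally show "emeasure (distr lborel borel vec_to_complex) (box l v) = ennreal (\<Prod>b\<in>Basis. (v - l) \<bullet> b)" .
qed simp

lemma lborel_distr_rotation:
  fixes c :: complex
  assumes "cmod c = 1"
  shows "distr lborel borel ((*) c) = lborel"
proof -
  define T :: "real^2 \<Rightarrow> real^2" where
    "T v = (\<chi> i. if i = 1 then Re c * v $ 1 - Im c * v $ 2 else Re c * v $ 2 + Im c * v $ 1)" for v
  have c: "(Re c)\<^sup>2 + (Im c)\<^sup>2 = 1"
    using assms by (simp add: cmod_power2[symmetric])
  have "linear T"
    by (rule linearI) (auto simp: T_def vec_eq_iff algebra_simps)
  moreover have "norm (T v) = norm v" for v
  proof -
    have "(Re c * v $ 1 - Im c * v $ 2)\<^sup>2 + (Re c * v $ 2 + Im c * v $ 1)\<^sup>2 =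
       ((Re c)\<^sup>2 + (Im c)\<^sup>2) * ((v $ 1)\<^sup>2 + (v $ 2)\<^sup>2)"
      by (simp add: power2_eq_square algebra_simps)
    then show ?thesis
      by (simp add: norm_vec_def L2_set_def UNIV_2 T_def c)
  qed
  ultimately have T: "orthogonal_transformation T"
    by (simp add: orthogonal_transformation)
  have [measurable]: "T \<in> borel_measurable borel"
    using \<open>linear T\<close> linear_continuous_on linear_conv_bounded_linear
    by (intro borel_measurable_continuous_onI) blast
  have comp: "(*) c \<circ> vec_to_complex = vec_to_complex \<circ> T"
    by (auto simp: fun_eq_iff vec_to_complex_def T_def complex_eq_iff)
  have "distr lborel borel ((*) c) = distr (distr lborel borel vec_to_complex) borel ((*) c)"
    by (simp add: distr_vec_to_complex)
  also have "\<dots> = distr lborel borel (vec_to_complex \<circ> T)"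
    by (subst distr_distr) (auto simp: comp)
  also have "\<dots> = distr (distr lborel borel T) borel vec_to_complex"
    by (subst distr_distr) auto
  also have "\<dots> = lborel"
    by (simp add: lborel_distr_orthogonal[OF T] distr_vec_to_complex)
  finally show ?thesis .
qed

text \<open>The unit circle is traversed once on \<open>[0, 1]\<close>, the parametrisation that \<open>circlepath\<close> uses.\<close>
definition unit_circle :: "real \<Rightarrow> complex" where
  "unit_circle t = exp (2 * of_real pi * \<i> * of_real t)"

lemma norm_unit_circle [simp]: "cmod (unit_circle t) = 1"
  by (simp add: unit_circle_def)

lemma continuous_unit_circle [continuous_intros]: "continuous_on A unit_circle"
  unfolding unit_circle_def by (intro continuous_intros)

lemma measurable_unit_circle [measurable]: "unit_circle \<in> borel_measurable borel"
  by (intro borel_measurable_continuous_onI continuous_intros)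

lemma measurable_entire:
  assumes "G holomorphic_on UNIV"
  shows "G \<in> borel_measurable borel"
  using assms by (intro borel_measurable_continuous_onI holomorphic_on_imp_continuous_on)

text \<open>The point \<open>w\<close> sits inside the argument so that one parametrised circle of radius 1 covers all radii.\<close>
lemma circle_mean_value:
  assumes G: "G holomorphic_on UNIV"
  shows "((\<lambda>t. G (w * unit_circle t)) has_integral G 0) {0..1}"
proof -
  have "G \<circ> (\<lambda>v. w * v) holomorphic_on UNIV"
    by (rule holomorphic_on_compose_gen[OF _ G]) (auto intro!: holomorphic_intros)
  then have "(\<lambda>v. G (w * v)) holomorphic_on cball 0 1"
    by (auto simp: o_def elim: holomorphic_on_subset)
  then have "((\<lambda>v. G (w * v) / (v - 0)) has_contour_integral (2 * of_real pi * \<i> * G (w * 0)))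
      (circlepath 0 1)"
    by (rule Cauchy_integral_circlepath_simple) simp
  then have int: "((\<lambda>t. G (w * circlepath 0 1 t) / (circlepath 0 1 t - 0)
      * vector_derivative (circlepath 0 1) (at t within {0..1})) has_integral (2 * of_real pi * \<i> * G 0)) {0..1}"
    by (simp add: has_contour_integral_def)
  have "G (w * circlepath 0 1 t) / (circlepath 0 1 t - 0) * vector_derivative (circlepath 0 1) (at t within {0..1})
      = 2 * of_real pi * \<i> * G (w * unit_circle t)" if "t \<in> {0..1}" for t
  proof -
    have "vector_derivative (circlepath 0 1) (at t within {0..1}) = 2 * of_real pi * \<i> * unit_circle t"
      using vector_derivative_circlepath01[of t 0 1] that by (simp add: unit_circle_def)
    moreover have "circlepath 0 1 t = unit_circle t"
      by (simp add: circlepath unit_circle_def)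
    moreover have "unit_circle t \<noteq> 0"
      by (simp add: unit_circle_def)
    ultimately show ?thesis by simp
  qed
  from has_integral_eq[OF this int]
  have "((\<lambda>t. 2 * of_real pi * \<i> * G (w * unit_circle t)) has_integral (2 * of_real pi * \<i> * G 0)) {0..1}" .
  then have "((\<lambda>t. (1 / (2 * of_real pi * \<i>)) * (2 * of_real pi * \<i> * G (w * unit_circle t)))
      has_integral (1 / (2 * of_real pi * \<i>)) * (2 * of_real pi * \<i> * G 0)) {0..1}"
    by (rule has_integral_mult_right)
  then show ?thesis by simp
qed

lemma circle_submean_value:
  assumes G: "G holomorphic_on UNIV"
  shows "ennreal (cmod (G 0)) \<le> (\<integral>\<^sup>+t. ennreal (cmod (G (w * unit_circle t))) * indicator {0..1} t \<partial>lborel)"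
proof -
  let ?f = "\<lambda>t. G (w * unit_circle t)"
  have "continuous_on {0..1} (G \<circ> (\<lambda>t. w * unit_circle t))"
    by (intro continuous_on_compose continuous_intros
        continuous_on_subset[OF holomorphic_on_imp_continuous_on[OF G]]) auto
  then have int: "set_integrable lborel {0..1} ?f"
    unfolding set_integrable_def by (intro borel_integrable_compact) (auto simp: o_def)
  have "(LINT t:{0..1}|lborel. ?f t) = G 0"
    using set_borel_integral_eq_integral(2)[OF int] integral_unique[OF circle_mean_value[OF G, of w]] by simp
  then have "ennreal (cmod (G 0)) \<le> (\<integral>\<^sup>+t. ennreal (cmod (indicator {0..1} t *\<^sub>R ?f t)) \<partial>lborel)"
    using integral_norm_bound_ennreal[OF int[unfolded set_integrable_def]]
    by (simp add: set_lebesgue_integral_def)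
  also have "\<dots> = (\<integral>\<^sup>+t. ennreal (cmod (?f t)) * indicator {0..1} t \<partial>lborel)"
    by (intro nn_integral_cong) (auto simp: indicator_def)
  finally show ?thesis .
qed

text \<open>
  The circle estimate holds for every \<open>w\<close> of the unit disc. Integrating it over \<open>w\<close> and exchanging the
  integrals leaves, for each angle, the integral of \<open>\<bar>G\<bar>\<close> over a rotated disc.
\<close>
lemma disc_submean_value:
  assumes G: "G holomorphic_on UNIV"
  shows "ennreal (cmod (G 0)) * emeasure lborel (ball (0::complex) 1) \<le>
    (\<integral>\<^sup>+w. ennreal (cmod (G w)) * indicator (ball 0 1) w \<partial>lborel)"
proof -
  note [measurable] = measurable_entire[OF G]
  define J where "J w = ennreal (cmod (G w)) * indicator (ball 0 1) w" for w
  define I :: "real \<Rightarrow> ennreal" where "I = indicator {0..1}"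
  have [measurable]: "J \<in> borel_measurable borel" "I \<in> borel_measurable borel"
    unfolding J_def I_def
    by (intro borel_measurable_times_ennreal borel_measurable_indicator borel_open; measurable)
       (intro borel_measurable_indicator borel_closed closed_atLeastAtMost)
  have "ennreal (cmod (G 0)) * emeasure lborel (ball (0::complex) 1) =
      (\<integral>\<^sup>+w. ennreal (cmod (G 0)) * indicator (ball 0 1) (w::complex) \<partial>lborel)"
    by (subst nn_integral_cmult_indicator) auto
  also have "\<dots> \<le> (\<integral>\<^sup>+w. (\<integral>\<^sup>+t. J (w * unit_circle t) * I t \<partial>lborel) \<partial>lborel)"
  proof (rule nn_integral_mono)
    fix w :: complex
    show "ennreal (cmod (G 0)) * indicator (ball 0 1) w \<le> (\<integral>\<^sup>+t. J (w * unit_circle t) * I t \<partial>lborel)"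
      using circle_submean_value[OF G, of w]
      by (cases "w \<in> ball 0 1") (auto simp: norm_mult J_def I_def)
  qed
  also have "\<dots> = (\<integral>\<^sup>+t. (\<integral>\<^sup>+w. J (w * unit_circle t) * I t \<partial>lborel) \<partial>lborel)"
    by (rule lborel_pair.Fubini') measurable
  also have "\<dots> = (\<integral>\<^sup>+t. (\<integral>\<^sup>+w. J w \<partial>lborel) * I t \<partial>lborel)"
  proof (rule nn_integral_cong)
    fix t :: real
    have "(\<integral>\<^sup>+w. J (w * unit_circle t) \<partial>lborel) = (\<integral>\<^sup>+w. J w \<partial>distr lborel borel ((*) (unit_circle t)))"
      by (subst nn_integral_distr) (auto simp: mult.commute)
    also have "\<dots> = (\<integral>\<^sup>+w. J w \<partial>lborel)"
      by (simp add: lborel_distr_rotation)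
    finally show "(\<integral>\<^sup>+w. J (w * unit_circle t) * I t \<partial>lborel) = (\<integral>\<^sup>+w. J w \<partial>lborel) * I t"
      by (subst nn_integral_multc) auto
  qed
  also have "\<dots> = (\<integral>\<^sup>+w. J w \<partial>lborel)"
    unfolding I_def by (subst nn_integral_cmult_indicator) auto
  finally show ?thesis by (simp add: J_def)
qed

text \<open>
  This is the sub-mean value property of \<open>F\<^sup>2\<close> on the unit disc around \<open>z\<close>, where the weight is at least
  \<open>exp (- \<alpha> (\<bar>z\<bar> + 1)\<^sup>2)\<close>. The extra factor \<open>exp (\<alpha> \<bar>z\<bar>)\<close> compared with the sharp bound is
  harmless, since growth is later measured up to such factors.
\<close>
lemma Fock_space_pointwise_bound:
  assumes F: "F \<in> Fock_space \<alpha>" and \<alpha>: "\<alpha> > 0"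
  shows "\<exists>A. \<forall>z. cmod (F z) \<le> A * exp (\<alpha> / 2 * (cmod z)\<^sup>2 + \<alpha> * cmod z)"
proof -
  have hol: "F holomorphic_on UNIV"
    and int: "integrable lborel (\<lambda>z. (cmod (F z))\<^sup>2 * exp (- \<alpha> * (cmod z)\<^sup>2))"
    using F by (auto simp: Fock_space_def)
  note [measurable] = measurable_entire[OF hol]
  define N where "N = (\<integral>z. (cmod (F z))\<^sup>2 * exp (- \<alpha> * (cmod z)\<^sup>2) \<partial>lborel)"
  define V where "V = measure lborel (ball (0::complex) 1)"
  have V: "V > 0" by (simp add: V_def content_ball_pos)
  have N: "N \<ge> 0" unfolding N_def by (intro integral_nonneg_AE) auto
  have nnN: "(\<integral>\<^sup>+z. ennreal ((cmod (F z))\<^sup>2 * exp (- \<alpha> * (cmod z)\<^sup>2)) \<partial>lborel) = ennreal N"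
    unfolding N_def using int by (intro nn_integral_eq_integral) auto
  have main: "(cmod (F z))\<^sup>2 * V \<le> exp (\<alpha> * (cmod z + 1)\<^sup>2) * N" for z
  proof -
    let ?G = "\<lambda>w. (F (z + w))\<^sup>2"
    let ?E = "exp (\<alpha> * (cmod z + 1)\<^sup>2)"
    have "F \<circ> (\<lambda>w. z + w) holomorphic_on UNIV"
      by (rule holomorphic_on_compose_gen[OF _ hol]) (auto intro!: holomorphic_intros)
    then have "?G holomorphic_on UNIV"
      by (intro holomorphic_intros) (simp add: o_def)
    then have "ennreal ((cmod (F z))\<^sup>2) * emeasure lborel (ball (0::complex) 1) \<le>
      (\<integral>\<^sup>+w. ennreal ((cmod (F (z + w)))\<^sup>2) * indicator (ball 0 1) w \<partial>lborel)"
      using disc_submean_value[of ?G] by (simp add: norm_power)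
    also have "\<dots> \<le> (\<integral>\<^sup>+w. ennreal ?E * ennreal ((cmod (F (z + w)))\<^sup>2 * exp (- \<alpha> * (cmod (z + w))\<^sup>2)) \<partial>lborel)"
    proof (rule nn_integral_mono)
      fix w :: complex
      show "ennreal ((cmod (F (z + w)))\<^sup>2) * indicator (ball 0 1) w \<le>
          ennreal ?E * ennreal ((cmod (F (z + w)))\<^sup>2 * exp (- \<alpha> * (cmod (z + w))\<^sup>2))"
      proof (cases "w \<in> ball 0 1")
        case True
        then have "(cmod (z + w))\<^sup>2 \<le> (cmod z + 1)\<^sup>2"
          using norm_triangle_ineq[of z w] by (intro power_mono) auto
        then have "1 \<le> ?E * exp (- \<alpha> * (cmod (z + w))\<^sup>2)"
          using \<alpha> by (simp flip: exp_add)
        then have "(cmod (F (z + w)))\<^sup>2 * 1 \<le> (cmod (F (z + w)))\<^sup>2 * (?E * exp (- \<alpha> * (cmod (z + w))\<^sup>2))"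
          by (intro mult_left_mono) auto
        with True show ?thesis
          by (simp add: ennreal_mult[symmetric] mult_ac ennreal_leI)
      qed auto
    qed
    also have "\<dots> = ennreal ?E * (\<integral>\<^sup>+w. ennreal ((cmod (F (z + w)))\<^sup>2 * exp (- \<alpha> * (cmod (z + w))\<^sup>2)) \<partial>lborel)"
      by (rule nn_integral_cmult) measurable
    also have "(\<integral>\<^sup>+w. ennreal ((cmod (F (z + w)))\<^sup>2 * exp (- \<alpha> * (cmod (z + w))\<^sup>2)) \<partial>lborel) =
        (\<integral>\<^sup>+w. ennreal ((cmod (F w))\<^sup>2 * exp (- \<alpha> * (cmod w)\<^sup>2)) \<partial>distr lborel borel ((+) z))"
      by (subst nn_integral_distr) auto
    also have "\<dots> = ennreal N"
      by (simp only: lborel_distr_plus nnN)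
    finally have "ennreal ((cmod (F z))\<^sup>2) * emeasure lborel (ball (0::complex) 1) \<le> ennreal ?E * ennreal N" .
    moreover have "emeasure lborel (ball (0::complex) 1) = ennreal V"
      unfolding V_def using emeasure_lborel_ball_finite[of "0::complex" 1]
      by (intro emeasure_eq_ennreal_measure) auto
    ultimately show ?thesis
      using V N by (simp add: ennreal_mult[symmetric])
  qed
  define A where "A = sqrt (exp \<alpha> * N / V)"
  have "cmod (F z) \<le> A * exp (\<alpha> / 2 * (cmod z)\<^sup>2 + \<alpha> * cmod z)" for z
  proof (rule power2_le_imp_le)
    have "exp (\<alpha> * (cmod z + 1)\<^sup>2) = exp \<alpha> * (exp (\<alpha> / 2 * (cmod z)\<^sup>2 + \<alpha> * cmod z))\<^sup>2"
      by (simp add: power2_eq_square field_simps flip: exp_add)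
    then show "(cmod (F z))\<^sup>2 \<le> (A * exp (\<alpha> / 2 * (cmod z)\<^sup>2 + \<alpha> * cmod z))\<^sup>2"
      using main[of z] V N by (simp add: A_def power_mult_distrib field_simps)
    show "0 \<le> A * exp (\<alpha> / 2 * (cmod z)\<^sup>2 + \<alpha> * cmod z)"
      using V N by (simp add: A_def)
  qed
  then show ?thesis by blast
qed

section \<open>An integrable weight on the plane\<close>

lemma nn_integral_inverse_1_plus_square_finite:
  "(\<integral>\<^sup>+x. ennreal (inverse (1 + x\<^sup>2)) \<partial>lborel) < \<infinity>"
proof -
  let ?h = "\<lambda>x::real. ennreal (inverse (1 + x\<^sup>2)) * indicator {0..} x"
  have h: "(\<integral>\<^sup>+x. ?h x \<partial>lborel) = ennreal (pi / 2 - arctan 0)"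
    by (intro nn_integral_FTC_atLeast DERIV_arctan tendsto_arctan_at_top) auto
  have "(\<integral>\<^sup>+x. ?h (- x) \<partial>lborel) = (\<integral>\<^sup>+x. ?h x \<partial>distr lborel borel uminus)"
    by (subst nn_integral_distr) auto
  then have h': "(\<integral>\<^sup>+x. ?h (- x) \<partial>lborel) = (\<integral>\<^sup>+x. ?h x \<partial>lborel)"
    by (simp only: lborel_distr_uminus)
  have "(\<integral>\<^sup>+x. ennreal (inverse (1 + x\<^sup>2)) \<partial>lborel) \<le> (\<integral>\<^sup>+x. ?h x + ?h (- x) \<partial>lborel)"
    by (intro nn_integral_mono) (auto simp: indicator_def)
  also have "\<dots> = (\<integral>\<^sup>+x. ?h x \<partial>lborel) + (\<integral>\<^sup>+x. ?h (- x) \<partial>lborel)"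
    by (rule nn_integral_add) auto
  also have "\<dots> < \<infinity>"
    unfolding h' h by simp
  finally show ?thesis .
qed

text \<open>The integrand is dominated by the product \<open>1 / ((1 + x\<^sup>2) (1 + y\<^sup>2))\<close>, whose integral factorises.\<close>
lemma integrable_quartic_decay: "integrable lborel (\<lambda>z::complex. 1 / (1 + (cmod z)\<^sup>2)\<^sup>2)"
proof (rule integrableI_bounded)
  let ?f = "\<lambda>(b::complex) x. ennreal (inverse (1 + x\<^sup>2))"
  show "(\<lambda>z::complex. 1 / (1 + (cmod z)\<^sup>2)\<^sup>2) \<in> borel_measurable lborel"
    by measurable
  have fin: "(\<integral>\<^sup>+x. ennreal (inverse (1 + x\<^sup>2)) \<partial>lborel) < \<infinity>"
    by (fact nn_integral_inverse_1_plus_square_finite)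
  have "(\<integral>\<^sup>+z. ennreal (norm (1 / (1 + (cmod z)\<^sup>2)\<^sup>2)) \<partial>(lborel :: complex measure)) \<le>
     (\<integral>\<^sup>+z. (\<Prod>b\<in>Basis. ?f b (z \<bullet> b)) \<partial>lborel)"
  proof (rule nn_integral_mono)
    fix z :: complex
    have "(1 + (Re z)\<^sup>2) * (1 + (Im z)\<^sup>2) \<le> (1 + (cmod z)\<^sup>2) * (1 + (cmod z)\<^sup>2)"
      by (intro mult_mono) (auto simp: cmod_power2)
    moreover have "0 < (1 + (Re z)\<^sup>2) * (1 + (Im z)\<^sup>2)"
      by (intro mult_pos_pos add_pos_nonneg) auto
    ultimately have "1 / (1 + (cmod z)\<^sup>2)\<^sup>2 \<le> 1 / ((1 + (Re z)\<^sup>2) * (1 + (Im z)\<^sup>2))"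
      unfolding power2_eq_square[of "1 + (cmod z)\<^sup>2"] by (intro divide_left_mono) (auto intro: mult_pos_pos)
    then show "ennreal (norm (1 / (1 + (cmod z)\<^sup>2)\<^sup>2)) \<le> (\<Prod>b\<in>Basis. ?f b (z \<bullet> b))"
      by (simp add: Basis_complex_def ennreal_mult[symmetric] ennreal_leI field_simps)
  qed
  also have "\<dots> = (\<Prod>b\<in>(Basis::complex set). (\<integral>\<^sup>+x. ennreal (inverse (1 + x\<^sup>2)) \<partial>lborel))"
    by (rule nn_integral_lborel_prod) auto
  also have "\<dots> < \<infinity>"
    using fin by (simp add: Basis_complex_def ennreal_mult_less_top)
  finally show "(\<integral>\<^sup>+z. ennreal (norm (1 / (1 + (cmod z)\<^sup>2)\<^sup>2)) \<partial>(lborel :: complex measure)) < \<infinity>" .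
qed

section \<open>The q-Pochhammer product\<close>

definition qpoch :: "complex \<Rightarrow> complex \<Rightarrow> complex" where
  "qpoch q w = (\<Prod>n. 1 - q ^ n * w)"

lemma convergent_prod_qpoch:
  fixes q w :: complex
  assumes "norm q < 1"
  shows "convergent_prod (\<lambda>n. 1 - q ^ n * w)"
proof -
  have "summable (\<lambda>n. norm q ^ n * norm w)"
    using assms by (intro summable_mult2 summable_geometric) simp
  then have "summable (\<lambda>n. norm (1 - q ^ n * w - 1))"
    by (simp add: norm_mult norm_power)
  then show ?thesis
    by (intro abs_convergent_prod_imp_convergent_prod summable_imp_abs_convergent_prod)
qed

lemma qpoch_tendsto:
  assumes "norm q < 1"
  shows "(\<lambda>N. \<Prod>n<N. 1 - q ^ n * w) \<longlonglongrightarrow> qpoch q w"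
  unfolding qpoch_def
  using convergent_prod_LIMSEQ[OF convergent_prod_qpoch[OF assms, of w]]
  by (simp add: LIMSEQ_lessThan_iff_atMost)

text \<open>Splitting off the first factor gives the functional equation behind the quasi-periodicity of theta.\<close>
lemma qpoch_rec:
  assumes "norm q < 1"
  shows "qpoch q w = (1 - w) * qpoch q (q * w)"
proof -
  have "(\<lambda>N. \<Prod>n<Suc N. 1 - q ^ n * w) \<longlonglongrightarrow> qpoch q w"
    using qpoch_tendsto[OF assms] by (rule LIMSEQ_Suc)
  moreover have "(\<Prod>n<Suc N. 1 - q ^ n * w) = (1 - w) * (\<Prod>n<N. 1 - q ^ n * (q * w))" for N
    by (subst prod.lessThan_Suc_shift) (simp add: mult_ac)
  ultimately have "(\<lambda>N. (1 - w) * (\<Prod>n<N. 1 - q ^ n * (q * w))) \<longlonglongrightarrow> qpoch q w"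
    by simp
  moreover have "(\<lambda>N. (1 - w) * (\<Prod>n<N. 1 - q ^ n * (q * w))) \<longlonglongrightarrow> (1 - w) * qpoch q (q * w)"
    by (intro tendsto_intros qpoch_tendsto assms)
  ultimately show ?thesis
    using LIMSEQ_unique by blast
qed

lemma qpoch_eq_0D:
  assumes "norm q < 1" "qpoch q w = 0"
  obtains n where "q ^ n * w = 1"
proof -
  have "\<exists>n. 1 - q ^ n * w = 0"
    using prodinf_nonzero[OF convergent_prod_qpoch[OF assms(1)], of w] assms(2)
    unfolding qpoch_def by blast
  with that show thesis by auto
qed

lemma holomorphic_qpoch:
  assumes "norm q < 1"
  shows "qpoch q holomorphic_on UNIV"
proof (rule holomorphic_uniform_sequence)
  show "(\<lambda>w. \<Prod>n<N. 1 - q ^ n * w) holomorphic_on UNIV" for N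
    by (intro holomorphic_intros)
  fix x :: complex
  define A where "A = cball x 1"
  have "uniformly_convergent_on A (\<lambda>N w. \<Sum>n<N. norm (1 - q ^ n * w - 1))"
  proof (rule Weierstrass_m_test')
    show "summable (\<lambda>n. norm q ^ n * (norm x + 1))"
      using assms by (intro summable_mult2 summable_geometric) auto
    fix n w assume "w \<in> A"
    then have "norm w \<le> norm x + 1"
      unfolding A_def mem_cball using norm_triangle_ineq2[of w x]
      by (simp add: dist_norm norm_minus_commute)
    then show "norm (norm (1 - q ^ n * w - 1)) \<le> norm q ^ n * (norm x + 1)"
      by (simp add: norm_mult norm_power mult_left_mono)
  qed
  then have "uniformly_convergent_on A (\<lambda>N w. \<Prod>n<N. 1 - q ^ n * w)"
    by (intro uniformly_convergent_on_prod') (auto simp: A_def intro!: continuous_intros)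
  then obtain l where l: "uniform_limit A (\<lambda>N w. \<Prod>n<N. 1 - q ^ n * w) l sequentially"
    by (auto simp: uniformly_convergent_on_def)
  have "l w = qpoch q w" if "w \<in> A" for w
    using tendsto_uniform_limitI[OF l that] qpoch_tendsto[OF assms] LIMSEQ_unique by blast
  then have "uniform_limit A (\<lambda>N w. \<Prod>n<N. 1 - q ^ n * w) (qpoch q) sequentially"
    using l by (simp cong: uniform_limit_cong')
  then show "\<exists>d>0. cball x d \<subseteq> UNIV \<and>
      uniform_limit (cball x d) (\<lambda>N w. \<Prod>n<N. 1 - q ^ n * w) (qpoch q) sequentially"
    unfolding A_def by (intro exI[of _ 1]) auto
qed auto

section \<open>Division by a function with simple zeros\<close>

lemma open_nonzero_set:
  fixes f :: "complex \<Rightarrow> complex"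
  assumes "open A" "f holomorphic_on A"
  shows "open {z \<in> A. f z \<noteq> 0}"
proof -
  have "open (A \<inter> f -` (- {0}))"
    using assms by (intro continuous_open_preimage holomorphic_on_imp_continuous_on) auto
  also have "A \<inter> f -` (- {0}) = {z \<in> A. f z \<noteq> 0}" by auto
  finally show ?thesis .
qed

text \<open>
  Near a zero \<open>a\<close> of \<open>S\<close>, both difference quotients at \<open>a\<close> are holomorphic and the one of \<open>S\<close> does not
  vanish, so the quotient of the two difference quotients extends \<open>f / S\<close>.
\<close>
lemma holomorphic_divide_simple_zeros:
  assumes A: "open A" and f: "f holomorphic_on A" and S: "S holomorphic_on A"
    and z: "\<And>z. z \<in> A \<Longrightarrow> S z = 0 \<Longrightarrow> f z = 0 \<and> deriv S z \<noteq> 0"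
  shows "(\<lambda>z. if S z = 0 then deriv f z / deriv S z else f z / S z) holomorphic_on A"
    (is "?h holomorphic_on A")
proof -
  have "?h field_differentiable at a" if a: "a \<in> A" for a
  proof (cases "S a = 0")
    case False
    have "open {z \<in> A. S z \<noteq> 0}"
      using A S by (rule open_nonzero_set)
    moreover have "(\<lambda>z. f z / S z) holomorphic_on {z \<in> A. S z \<noteq> 0}"
      by (intro holomorphic_intros holomorphic_on_subset[OF f] holomorphic_on_subset[OF S]) auto
    then have "?h holomorphic_on {z \<in> A. S z \<noteq> 0}"
      by (rule holomorphic_transform) auto
    ultimately show ?thesis
      using a False by (auto simp: holomorphic_on_open field_differentiable_def)
  next
    case True
    define f1 where "f1 = (\<lambda>z. if z = a then deriv f a else (f z - f a) / (z - a))"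
    define s1 where "s1 = (\<lambda>z. if z = a then deriv S a else (S z - S a) / (z - a))"
    have f1: "f1 holomorphic_on A" and s1: "s1 holomorphic_on A"
      unfolding f1_def s1_def by (intro pole_lemma_open f S A)+
    have B: "open {z \<in> A. s1 z \<noteq> 0}"
      using A s1 by (rule open_nonzero_set)
    have "(\<lambda>z. f1 z / s1 z) holomorphic_on {z \<in> A. s1 z \<noteq> 0}"
      by (intro holomorphic_intros holomorphic_on_subset[OF f1] holomorphic_on_subset[OF s1]) auto
    then have "?h holomorphic_on {z \<in> A. s1 z \<noteq> 0}"
      by (rule holomorphic_transform) (use True z[OF a] in \<open>auto simp: f1_def s1_def split: if_splits\<close>)
    moreover have "a \<in> {z \<in> A. s1 z \<noteq> 0}"
      using a True z[OF a] by (auto simp: s1_def)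
    ultimately show ?thesis
      using B by (auto simp: holomorphic_on_open field_differentiable_def)
  qed
  then show ?thesis
    by (simp add: field_differentiable_at_within holomorphic_on_def)
qed

section \<open>Sums and periodicity over the integers\<close>

lemma sum_exp_neg_abs_int_le:
  assumes "c > 0"
  shows "(\<Sum>m = - int N..int N. exp (- (c * \<bar>real_of_int m\<bar>))) \<le> 2 / (1 - exp (- c))"
proof -
  define r where "r = exp (- c)"
  have r: "0 < r" "r < 1" using assms by (auto simp: r_def)
  let ?f = "\<lambda>m::int. exp (- (c * \<bar>real_of_int m\<bar>))"
  have f: "exp (- (c * real k)) = r ^ k" for k
    by (simp add: r_def mult.commute flip: exp_of_nat_mult)
  have geom: "(\<Sum>k\<le>N. r ^ k) \<le> 1 / (1 - r)"
    using sum_le_suminf[of "\<lambda>k. r ^ k" "{..N}"] r by (simp add: suminf_geometric)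
  have "sum ?f {- int N..int N} \<le> sum ?f (int ` {..N} \<union> (\<lambda>k. - int k) ` {..N})"
  proof (rule sum_mono2)
    show "{- int N..int N} \<subseteq> int ` {..N} \<union> (\<lambda>k. - int k) ` {..N}"
    proof
      fix m assume "m \<in> {- int N..int N}"
      then show "m \<in> int ` {..N} \<union> (\<lambda>k. - int k) ` {..N}"
        by (cases m rule: int_cases2) auto
    qed
  qed auto
  also have "\<dots> \<le> sum ?f (int ` {..N}) + sum ?f ((\<lambda>k. - int k) ` {..N})"
    by (simp add: sum_Un sum_nonneg)
  also have "\<dots> = 2 * (\<Sum>k\<le>N. r ^ k)"
    by (subst (1 2) sum.reindex) (auto simp: inj_on_def f)
  also have "\<dots> \<le> 2 / (1 - r)"
    using geom by simp
  finally show ?thesis by (simp add: r_def)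
qed

lemma periodic_of_int:
  assumes "\<And>z. f (z + w) = f (z :: complex)"
  shows "f (z + of_int n * w) = f z"
proof -
  have nat: "f (z + of_nat k * w) = f z" for z k
  proof (induction k)
    case (Suc k)
    then show ?case
      using assms[of "z + of_nat k * w"] by (simp add: algebra_simps)
  qed simp
  show ?thesis
  proof (cases n rule: int_cases2)
    case (nonneg k)
    then show ?thesis using nat[of z k] by simp
  next
    case (nonpos k)
    then show ?thesis using nat[of "z - of_nat k * w" k] by simp
  qed
qed

section \<open>An entire function with simple zeros on the lattice\<close>

locale period_pair =
  fixes \<omega>1 \<omega>2 :: complex
  assumes periods: "lattice_periods \<omega>1 \<omega>2"
begin

definition area :: real where "area = lattice_area \<omega>1 \<omega>2"
definition \<Lambda> :: "complex set" where "\<Lambda> = period_lattice \<omega>1 \<omega>2"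
definition \<beta> :: real where "\<beta> = pi / area"

text \<open>The real coordinates with respect to the periods, written by Cramer's rule.\<close>
definition coord1 :: "complex \<Rightarrow> real" where "coord1 z = Im (cnj z * \<omega>2) / area"
definition coord2 :: "complex \<Rightarrow> real" where "coord2 z = Im (cnj \<omega>1 * z) / area"

lemma \<omega>1_nz: "\<omega>1 \<noteq> 0"
  using periods by (auto simp: lattice_periods_def)

lemma Im_ratio: "Im (\<omega>2 / \<omega>1) = area / (cmod \<omega>1)\<^sup>2"
  by (simp add: area_def lattice_area_def complex_div_cnj[of \<omega>2 \<omega>1] mult.commute
      flip: of_real_power)

lemma area_pos: "area > 0"
  using periods \<omega>1_nz by (simp add: lattice_periods_def Im_ratio zero_less_divide_iff)

lemma \<beta>_pos: "\<beta> > 0"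
  using area_pos by (simp add: \<beta>_def)

lemma lattice_coordinates: "z = of_real (coord1 z) * \<omega>1 + of_real (coord2 z) * \<omega>2"
proof -
  have "area * Re z = Im (cnj z * \<omega>2) * Re \<omega>1 + Im (cnj \<omega>1 * z) * Re \<omega>2"
       "area * Im z = Im (cnj z * \<omega>2) * Im \<omega>1 + Im (cnj \<omega>1 * z) * Im \<omega>2"
    by (simp_all add: area_def lattice_area_def algebra_simps)
  moreover have "Im (cnj z * \<omega>2) = area * coord1 z" "Im (cnj \<omega>1 * z) = area * coord2 z"
    using area_pos by (simp_all add: coord1_def coord2_def)
  ultimately have "area * Re z = area * (coord1 z * Re \<omega>1 + coord2 z * Re \<omega>2)"
       "area * Im z = area * (coord1 z * Im \<omega>1 + coord2 z * Im \<omega>2)"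
    by (simp_all only: distrib_left mult.assoc)
  then show ?thesis
    using area_pos by (simp add: complex_eq_iff)
qed

lemma coord1_add: "coord1 (z + w) = coord1 z + coord1 w" and coord2_add: "coord2 (z + w) = coord2 z + coord2 w"
  by (simp_all add: coord1_def coord2_def algebra_simps add_divide_distrib diff_divide_distrib)

lemma coord1_lattice [simp]: "coord1 (of_real a * \<omega>1 + of_real b * \<omega>2) = a"
  and coord2_lattice [simp]: "coord2 (of_real a * \<omega>1 + of_real b * \<omega>2) = b"
proof -
  have "Im (cnj (of_real a * \<omega>1 + of_real b * \<omega>2) * \<omega>2) = a * area"
       "Im (cnj \<omega>1 * (of_real a * \<omega>1 + of_real b * \<omega>2)) = b * area"
    by (simp_all add: area_def lattice_area_def algebra_simps)
  then show "coord1 (of_real a * \<omega>1 + of_real b * \<omega>2) = a" "coord2 (of_real a * \<omega>1 + of_real b * \<omega>2) = b"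
    using area_pos by (simp_all add: coord1_def coord2_def)
qed

lemma mem_\<Lambda>_iff: "z \<in> \<Lambda> \<longleftrightarrow> coord1 z \<in> \<int> \<and> coord2 z \<in> \<int>"
proof
  assume "z \<in> \<Lambda>"
  then obtain m n :: int where z: "z = of_int m * \<omega>1 + of_int n * \<omega>2"
    by (auto simp: \<Lambda>_def period_lattice_def)
  then have "z = of_real (of_int m) * \<omega>1 + of_real (of_int n) * \<omega>2" by simp
  then show "coord1 z \<in> \<int> \<and> coord2 z \<in> \<int>"
    by (simp only: coord1_lattice coord2_lattice Ints_of_int simp_thms)
next
  assume "coord1 z \<in> \<int> \<and> coord2 z \<in> \<int>"
  then obtain m n :: int where "coord1 z = of_int m" "coord2 z = of_int n"
    by (auto elim!: Ints_cases)
  then have "z = of_int m * \<omega>1 + of_int n * \<omega>2"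
    using lattice_coordinates[of z] by simp
  then show "z \<in> \<Lambda>"
    by (auto simp: \<Lambda>_def period_lattice_def)
qed

lemma \<Lambda>_add: "z \<in> \<Lambda> \<Longrightarrow> w \<in> \<Lambda> \<Longrightarrow> z + w \<in> \<Lambda>"
  by (auto simp: mem_\<Lambda>_iff coord1_add coord2_add)

lemma zero_in_\<Lambda>: "0 \<in> \<Lambda>" and \<omega>1_in_\<Lambda>: "\<omega>1 \<in> \<Lambda>"
  unfolding \<Lambda>_def period_lattice_def
  by (rule CollectI, rule exI[of _ 0], rule exI[of _ 0], simp)
     (rule CollectI, rule exI[of _ 1], rule exI[of _ 0], simp)

text \<open>
  With \<open>q = nome\<close> and \<open>w = exp_coord z\<close>, the factors are those of the Jacobi triple product that vanish
  for some \<open>w = q\<^sup>k\<close> with \<open>k\<close> an integer; in terms of \<open>z\<close> these are the lattice points. The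
  exponential factor in \<open>\<sigma>\<close> is chosen so that \<open>\<bar>\<sigma>\<bar>\<close> grows at the same Gaussian rate in all directions.
\<close>
definition nome :: complex where "nome = exp (2 * of_real pi * \<i> * (\<omega>2 / \<omega>1))"
definition exp_coord :: "complex \<Rightarrow> complex" where "exp_coord z = exp (2 * of_real pi * \<i> * (z / \<omega>1))"
definition theta :: "complex \<Rightarrow> complex" where
  "theta z = qpoch nome (exp_coord z) * qpoch nome (nome / exp_coord z)"
definition \<sigma> :: "complex \<Rightarrow> complex" where
  "\<sigma> z = theta z * exp (of_real \<beta> * cnj \<omega>1 / (2 * \<omega>1) * z\<^sup>2 - \<i> * of_real pi * (z / \<omega>1))"

lemma norm_nome: "norm nome < 1"
proof -
  have "Re (2 * of_real pi * \<i> * t) = - (2 * pi * Im t)" for t by simp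
  then have "Re (2 * of_real pi * \<i> * (\<omega>2 / \<omega>1)) = - (2 * pi * Im (\<omega>2 / \<omega>1))" .
  also have "\<dots> < 0"
    using periods by (simp add: lattice_periods_def)
  finally show ?thesis by (simp add: nome_def)
qed

lemma nome_nz: "nome \<noteq> 0" by (simp add: nome_def)

lemma exp_coord_nz: "exp_coord z \<noteq> 0" by (simp add: exp_coord_def)

lemma exp_coord_add_\<omega>1: "exp_coord (z + \<omega>1) = exp_coord z"
  using \<omega>1_nz exp_plus_2pin[of "2 * of_real pi * \<i> * (z / \<omega>1)" 1]
  by (simp add: exp_coord_def add_divide_distrib ring_distribs mult_ac)

lemma exp_coord_add_\<omega>2: "exp_coord (z + \<omega>2) = nome * exp_coord z"
  by (simp add: exp_coord_def nome_def add_divide_distrib ring_distribs exp_add mult_ac)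

text \<open>
  Replacing \<open>w\<close> by \<open>q w\<close> removes the factor \<open>1 - w\<close> from one product and adds \<open>1 - 1 / w\<close> to the other;
  the quotient of the two factors is \<open>- 1 / w\<close>.
\<close>
lemma theta_add_\<omega>2: "theta (z + \<omega>2) = - theta z / exp_coord z"
proof -
  define w where "w = exp_coord z"
  have w: "w \<noteq> 0" by (simp add: w_def exp_coord_nz)
  have 1: "theta (z + \<omega>2) = qpoch nome (nome * w) * qpoch nome (1 / w)"
    using nome_nz by (simp add: theta_def exp_coord_add_\<omega>2 w_def)
  have 2: "theta z = qpoch nome w * qpoch nome (nome / w)"
    by (simp add: theta_def w_def)
  have r1: "qpoch nome w = (1 - w) * qpoch nome (nome * w)"
    and r2: "qpoch nome (1 / w) = (1 - 1 / w) * qpoch nome (nome / w)"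
    using qpoch_rec[OF norm_nome, of w] qpoch_rec[OF norm_nome, of "1 / w"] by simp_all
  have "theta (z + \<omega>2) = - theta z / w"
    unfolding 1 2 r2 by (subst r1) (use w in \<open>simp add: field_simps\<close>)
  then show ?thesis by (simp add: w_def)
qed

lemma holomorphic_exp_coord: "exp_coord holomorphic_on UNIV"
  unfolding exp_coord_def by (intro holomorphic_intros) (use \<omega>1_nz in auto)

lemma holomorphic_qpoch_compose: "f holomorphic_on UNIV \<Longrightarrow> (\<lambda>z. qpoch nome (f z)) holomorphic_on UNIV"
  using holomorphic_on_compose_gen[OF _ holomorphic_qpoch[OF norm_nome], of f UNIV]
  by (simp add: o_def)

lemma holomorphic_sigma: "\<sigma> holomorphic_on UNIV"
  unfolding \<sigma>_def theta_def
  by (intro holomorphic_intros holomorphic_qpoch_compose holomorphic_exp_coord) (use exp_coord_nz \<omega>1_nz in auto)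

text \<open>
  The two translation formulas have the same shape: \<open>\<bar>\<sigma>\<bar>\<close> picks up exactly the factor
  \<open>exp (\<beta> (\<bar>z + \<omega>\<bar>\<^sup>2 - \<bar>z\<bar>\<^sup>2) / 2)\<close>. For \<open>\<omega>1\<close> this fixes the quadratic coefficient in the exponent of
  \<open>\<sigma>\<close>; for \<open>\<omega>2\<close> it then requires \<open>\<beta>\<close> times the area to be \<open>\<pi>\<close>, and fixes the linear coefficient.
\<close>
lemma sigma_add_\<omega>1:
  "cmod (\<sigma> (z + \<omega>1)) = cmod (\<sigma> z) * exp (\<beta> * Re (cnj \<omega>1 * z) + \<beta> / 2 * (cmod \<omega>1)\<^sup>2)"
proof -
  have th: "theta (z + \<omega>1) = theta z"
    by (simp add: theta_def exp_coord_add_\<omega>1)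
  have "of_real \<beta> * cnj \<omega>1 / (2 * \<omega>1) * (z + \<omega>1)\<^sup>2 - \<i> * of_real pi * ((z + \<omega>1) / \<omega>1) =
     (of_real \<beta> * cnj \<omega>1 / (2 * \<omega>1) * z\<^sup>2 - \<i> * of_real pi * (z / \<omega>1))
     + (of_real \<beta> * (cnj \<omega>1 * z) + of_real \<beta> / 2 * (\<omega>1 * cnj \<omega>1) - \<i> * of_real pi)"
    using \<omega>1_nz by (simp add: field_simps power2_eq_square)
  moreover have "Re (of_real \<beta> * (cnj \<omega>1 * z) + of_real \<beta> / 2 * (\<omega>1 * cnj \<omega>1) - \<i> * of_real pi)
     = \<beta> * Re (cnj \<omega>1 * z) + \<beta> / 2 * (cmod \<omega>1)\<^sup>2"
    by (simp add: complex_norm_square[symmetric] flip: of_real_power)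
  ultimately show ?thesis
    by (simp add: \<sigma>_def th norm_mult exp_add)
qed

lemma sigma_add_\<omega>2:
  "cmod (\<sigma> (z + \<omega>2)) = cmod (\<sigma> z) * exp (\<beta> * Re (cnj \<omega>2 * z) + \<beta> / 2 * (cmod \<omega>2)\<^sup>2)"
proof -
  let ?Q = "\<lambda>z. of_real \<beta> * cnj \<omega>1 / (2 * \<omega>1) * z\<^sup>2 - \<i> * of_real pi * (z / \<omega>1)"
  let ?L = "2 * of_real pi * \<i> * (z / \<omega>1)"
  let ?D = "of_real \<beta> * (cnj \<omega>2 * z) + of_real \<beta> / 2 * (\<omega>2 * cnj \<omega>2)"
  have "\<omega>2 * cnj \<omega>1 - \<omega>1 * cnj \<omega>2 = 2 * \<i> * of_real area"
    by (simp add: complex_eq_iff area_def lattice_area_def algebra_simps)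
  then have "of_real \<beta> * (\<omega>2 * cnj \<omega>1 - \<omega>1 * cnj \<omega>2) = 2 * \<i> * of_real (\<beta> * area)"
    by simp
  \<comment> \<open>This plays the part of the Legendre relation between periods and quasi-periods.\<close>
  then have legendre: "of_real \<beta> * \<omega>2 * cnj \<omega>1 = of_real \<beta> * \<omega>1 * cnj \<omega>2 + 2 * \<i> * of_real pi"
    using area_pos by (simp add: \<beta>_def algebra_simps)
  have "2 * \<omega>1 * (?Q (z + \<omega>2) - ?Q z - ?L - ?D) =
      (of_real \<beta> * \<omega>2 * cnj \<omega>1) * (2 * z + \<omega>2) - 2 * \<i> * of_real pi * \<omega>2 - 4 * of_real pi * \<i> * z
      - of_real \<beta> * \<omega>1 * cnj \<omega>2 * (2 * z + \<omega>2)"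
    using \<omega>1_nz by (simp add: field_simps power2_eq_square)
  also have "\<dots> = 0"
    unfolding legendre by (simp add: algebra_simps)
  finally have "?Q (z + \<omega>2) - ?Q z - ?L - ?D = 0"
    using \<omega>1_nz by (metis mult_eq_0_iff zero_neq_numeral)
  moreover have "a = b + (c + d)" if "a - b - c - d = 0" for a b c d :: complex
    using that by (simp add: algebra_simps)
  ultimately have "?Q (z + \<omega>2) = ?Q z + (?L + ?D)"
    by blast
  then have "exp (?Q (z + \<omega>2)) = exp (?Q z) * (exp_coord z * exp ?D)"
    unfolding exp_coord_def by (simp only: exp_add)
  then have "\<sigma> (z + \<omega>2) = - \<sigma> z * exp ?D"
    using exp_coord_nz[of z] by (simp add: \<sigma>_def theta_add_\<omega>2)
  moreover have "Re ?D = \<beta> * Re (cnj \<omega>2 * z) + \<beta> / 2 * (cmod \<omega>2)\<^sup>2"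
    by (simp add: complex_norm_square[symmetric] flip: of_real_power)
  ultimately show ?thesis
    by (simp add: norm_mult)
qed

text \<open>
  All later estimates of \<open>\<sigma>\<close> go through this weighted modulus: being continuous and periodic, it is controlled
  by its values on a compact period parallelogram.
\<close>
definition weighted_sigma :: "complex \<Rightarrow> real" where
  "weighted_sigma z = cmod (\<sigma> z) * exp (- \<beta> / 2 * (cmod z)\<^sup>2)"

lemma norm_sigma: "cmod (\<sigma> z) = weighted_sigma z * exp (\<beta> / 2 * (cmod z)\<^sup>2)"
  by (simp add: weighted_sigma_def flip: exp_add)

lemma weighted_sigma_periodicI:
  assumes "cmod (\<sigma> (z + w)) = cmod (\<sigma> z) * exp (\<beta> * Re (cnj w * z) + \<beta> / 2 * (cmod w)\<^sup>2)"
  shows "weighted_sigma (z + w) = weighted_sigma z"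
proof -
  have "(cmod (z + w))\<^sup>2 = (cmod z)\<^sup>2 + 2 * Re (cnj w * z) + (cmod w)\<^sup>2"
    unfolding cmod_power2 by (simp add: power2_eq_square algebra_simps)
  then have "\<beta> * Re (cnj w * z) + \<beta> / 2 * (cmod w)\<^sup>2 + - \<beta> / 2 * (cmod (z + w))\<^sup>2 = - \<beta> / 2 * (cmod z)\<^sup>2"
    by (simp add: algebra_simps)
  then show ?thesis
    unfolding weighted_sigma_def assms by (simp add: mult.assoc flip: exp_add)
qed

lemma weighted_sigma_periodic:
  assumes "l \<in> \<Lambda>"
  shows "weighted_sigma (z + l) = weighted_sigma z"
proof -
  obtain m n where l: "l = of_int m * \<omega>1 + of_int n * \<omega>2"
    using assms by (auto simp: \<Lambda>_def period_lattice_def)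
  have "weighted_sigma (z + of_int m * \<omega>1 + of_int n * \<omega>2) = weighted_sigma (z + of_int m * \<omega>1)"
    by (rule periodic_of_int[where f = weighted_sigma, OF weighted_sigma_periodicI[OF sigma_add_\<omega>2]])
  also have "\<dots> = weighted_sigma z"
    by (rule periodic_of_int[where f = weighted_sigma, OF weighted_sigma_periodicI[OF sigma_add_\<omega>1]])
  finally show ?thesis by (simp add: l add.assoc)
qed

lemma exp_coord_eq_nome_power_imp:
  assumes "exp_coord z = nome powi k"
  shows "z \<in> \<Lambda>"
proof -
  have "nome powi k = exp (of_int k * (2 * of_real pi * \<i> * (\<omega>2 / \<omega>1)))"
    by (simp add: nome_def exp_power_int)
  then have "exp (2 * of_real pi * \<i> * (z / \<omega>1)) = exp (of_int k * (2 * of_real pi * \<i> * (\<omega>2 / \<omega>1)))"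
    using assms by (simp add: exp_coord_def)
  then obtain m :: int where
    "2 * of_real pi * \<i> * (z / \<omega>1) = of_int k * (2 * of_real pi * \<i> * (\<omega>2 / \<omega>1)) + of_int (2 * m) * pi * \<i>"
    by (auto simp: exp_eq)
  then have "2 * of_real pi * \<i> * z = 2 * of_real pi * \<i> * (of_int m * \<omega>1 + of_int k * \<omega>2)"
    using \<omega>1_nz by (simp add: field_simps)
  then have "z = of_int m * \<omega>1 + of_int k * \<omega>2"
    by simp
  then show ?thesis
    by (auto simp: \<Lambda>_def period_lattice_def)
qed

lemma sigma_0: "\<sigma> 0 = 0"
  using qpoch_rec[OF norm_nome, of 1] by (simp add: \<sigma>_def theta_def exp_coord_def)

lemma sigma_eq_0_iff: "\<sigma> z = 0 \<longleftrightarrow> z \<in> \<Lambda>"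
proof
  assume "\<sigma> z = 0"
  then consider "qpoch nome (exp_coord z) = 0" | "qpoch nome (nome / exp_coord z) = 0"
    by (auto simp: \<sigma>_def theta_def)
  then show "z \<in> \<Lambda>"
  proof cases
    case 1
    then obtain n where "nome ^ n * exp_coord z = 1"
      using qpoch_eq_0D[OF norm_nome] by blast
    then have "exp_coord z = nome powi (- int n)"
      using nome_nz by (simp add: power_int_minus field_simps)
    then show ?thesis by (rule exp_coord_eq_nome_power_imp)
  next
    case 2
    then obtain n where "nome ^ n * (nome / exp_coord z) = 1"
      using qpoch_eq_0D[OF norm_nome] by blast
    then have "exp_coord z = nome powi (int (Suc n))"
      using exp_coord_nz[of z] unfolding power_int_of_nat by (simp add: field_simps)
    then show ?thesis by (rule exp_coord_eq_nome_power_imp)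
  qed
next
  assume "z \<in> \<Lambda>"
  then have "weighted_sigma z = 0"
    using weighted_sigma_periodic[of z 0] by (simp add: weighted_sigma_def sigma_0)
  then show "\<sigma> z = 0" by (simp add: weighted_sigma_def)
qed

text \<open>The factor \<open>1 - w\<close> of the product carries the zero at the origin; no other factor vanishes there.\<close>
lemma deriv_sigma_0: "deriv \<sigma> 0 \<noteq> 0"
proof -
  define k where "k z = qpoch nome (nome * exp_coord z) * qpoch nome (nome / exp_coord z) *
    exp (of_real \<beta> * cnj \<omega>1 / (2 * \<omega>1) * z\<^sup>2 - \<i> * of_real pi * (z / \<omega>1))" for z
  have "k holomorphic_on UNIV"
    unfolding k_def
    by (intro holomorphic_intros holomorphic_qpoch_compose holomorphic_exp_coord) (use exp_coord_nz \<omega>1_nz in auto)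
  then obtain k' where k': "(k has_field_derivative k') (at 0)"
    by (auto simp: holomorphic_on_open)
  have eq: "\<sigma> = (\<lambda>z. (1 - exp (2 * of_real pi * \<i> * (z / \<omega>1))) * k z)"
  proof
    fix z
    have "qpoch nome (exp_coord z) = (1 - exp_coord z) * qpoch nome (nome * exp_coord z)"
      by (rule qpoch_rec[OF norm_nome])
    then have "\<sigma> z = (1 - exp_coord z) * k z"
      by (simp only: \<sigma>_def theta_def k_def mult.assoc)
    then show "\<sigma> z = (1 - exp (2 * of_real pi * \<i> * (z / \<omega>1))) * k z"
      by (simp add: exp_coord_def)
  qed
  have "((\<lambda>z. 1 - exp (2 * of_real pi * \<i> * (z / \<omega>1))) has_field_derivative
      - (2 * of_real pi * \<i> / \<omega>1)) (at 0)"
    by (rule derivative_eq_intros refl | use \<omega>1_nz in simp)+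
  from DERIV_mult[OF this k']
  have "(\<sigma> has_field_derivative (- (2 * of_real pi * \<i> / \<omega>1) * k 0)) (at 0)"
    by (simp add: eq)
  then have "deriv \<sigma> 0 = - (2 * of_real pi * \<i> / \<omega>1) * k 0"
    by (rule DERIV_imp_deriv)
  moreover have "qpoch nome nome \<noteq> 0"
  proof
    assume "qpoch nome nome = 0"
    then obtain n where "nome ^ Suc n = 1"
      using qpoch_eq_0D[OF norm_nome] by (metis power_Suc2)
    then have "norm nome ^ Suc n = 1"
      by (metis norm_one norm_power)
    then show False
      using norm_nome power_less_one_iff[of "norm nome" "Suc n"] by simp
  qed
  ultimately show ?thesis
    using \<omega>1_nz by (simp add: k_def exp_coord_def)
qed

lemma isCont_sigma: "isCont \<sigma> z"
  using holomorphic_on_imp_continuous_on[OF holomorphic_sigma] by (simp add: continuous_on_eq_continuous_at)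

lemma continuous_on_weighted_sigma: "continuous_on A weighted_sigma"
  unfolding weighted_sigma_def
  by (intro continuous_intros continuous_at_imp_continuous_on) (auto intro: isCont_sigma)

text \<open>
  By periodicity of the weighted modulus, \<open>\<bar>\<sigma> (l + h) / h\<bar>\<close> and \<open>\<bar>\<sigma> h / h\<bar>\<close> differ, in the limit
  \<open>h \<rightarrow> 0\<close>, by a positive factor. So the zero at \<open>l\<close> is simple because the one at \<open>0\<close> is.
\<close>
lemma deriv_sigma_nz:
  assumes "l \<in> \<Lambda>"
  shows "deriv \<sigma> l \<noteq> 0"
proof
  assume d: "deriv \<sigma> l = 0"
  have D: "(\<sigma> has_field_derivative deriv \<sigma> z) (at z)" for z
    using holomorphic_sigma by (simp add: holomorphic_derivI)
  have "((\<lambda>h. (\<sigma> (l + h) - \<sigma> l) / h) \<longlongrightarrow> 0) (at 0)"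
    using D[of l] by (simp add: DERIV_def d)
  then have "((\<lambda>h. cmod ((\<sigma> (l + h) - \<sigma> l) / h) * exp (- \<beta> / 2 * (cmod (l + h))\<^sup>2)
       * exp (\<beta> / 2 * (cmod h)\<^sup>2)) \<longlongrightarrow>
        cmod 0 * exp (- \<beta> / 2 * (cmod (l + 0))\<^sup>2) * exp (\<beta> / 2 * (cmod 0)\<^sup>2)) (at 0)"
    by (intro tendsto_intros)
  moreover have "cmod ((\<sigma> (l + h) - \<sigma> l) / h) * exp (- \<beta> / 2 * (cmod (l + h))\<^sup>2)
       * exp (\<beta> / 2 * (cmod h)\<^sup>2) = cmod ((\<sigma> (0 + h) - \<sigma> 0) / h)" for h
  proof -
    have "cmod ((\<sigma> (l + h) - \<sigma> l) / h) * exp (- \<beta> / 2 * (cmod (l + h))\<^sup>2)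
       * exp (\<beta> / 2 * (cmod h)\<^sup>2) = weighted_sigma (h + l) * exp (\<beta> / 2 * (cmod h)\<^sup>2) / cmod h"
      using assms sigma_eq_0_iff[of l] by (simp add: weighted_sigma_def norm_divide add.commute)
    also have "\<dots> = cmod (\<sigma> h) / cmod h"
      by (simp only: weighted_sigma_periodic[OF assms] norm_sigma)
    finally show ?thesis by (simp add: sigma_0 norm_divide)
  qed
  ultimately have "((\<lambda>h. cmod ((\<sigma> (0 + h) - \<sigma> 0) / h)) \<longlongrightarrow> 0) (at 0)"
    by simp
  moreover have "((\<lambda>h. cmod ((\<sigma> (0 + h) - \<sigma> 0) / h)) \<longlongrightarrow> cmod (deriv \<sigma> 0)) (at 0)"
    using D[of 0] unfolding DERIV_def by (rule tendsto_norm)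
  ultimately show False
    using deriv_sigma_0 by (metis LIM_unique norm_eq_zero)
qed

section \<open>Period parallelograms\<close>

definition period_box :: "real \<Rightarrow> complex set" where
  "period_box r = {z. \<bar>coord1 z\<bar> \<le> r \<and> \<bar>coord2 z\<bar> \<le> r}"

lemma continuous_on_coord1 [continuous_intros]: "continuous_on A coord1"
  and continuous_on_coord2 [continuous_intros]: "continuous_on A coord2"
  unfolding coord1_def coord2_def using area_pos by (auto intro!: continuous_intros)

lemma closed_period_box: "closed (period_box r)"
  unfolding period_box_def by (intro closed_Collect_conj closed_Collect_le continuous_intros)

lemma compact_period_box: "compact (period_box r)"
proof -
  have "cmod z \<le> r * cmod \<omega>1 + r * cmod \<omega>2" if "z \<in> period_box r" for z
  proof -
    have "cmod z \<le> \<bar>coord1 z\<bar> * cmod \<omega>1 + \<bar>coord2 z\<bar> * cmod \<omega>2"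
      using norm_triangle_ineq[of "of_real (coord1 z) * \<omega>1" "of_real (coord2 z) * \<omega>2"]
      by (simp add: norm_mult flip: lattice_coordinates)
    also have "\<dots> \<le> r * cmod \<omega>1 + r * cmod \<omega>2"
      using that by (intro add_mono mult_right_mono) (auto simp: period_box_def)
    finally show ?thesis .
  qed
  then have "bounded (period_box r)"
    unfolding bounded_iff by blast
  then show ?thesis
    using closed_period_box compact_eq_bounded_closed by blast
qed

lemma period_box_translate:
  obtains l where "l \<in> \<Lambda>" "z - l \<in> period_box (1/2)"
    "coord1 l = of_int (round (coord1 z))" "coord2 l = of_int (round (coord2 z))"
proof
  let ?l = "of_real (of_int (round (coord1 z))) * \<omega>1 + of_real (of_int (round (coord2 z))) * \<omega>2"
  show XY: "coord1 ?l = of_int (round (coord1 z))" "coord2 ?l = of_int (round (coord2 z))"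
    by (rule coord1_lattice coord2_lattice)+
  show "?l \<in> \<Lambda>"
    unfolding mem_\<Lambda>_iff XY by simp
  have "coord1 (z - ?l) = coord1 z - coord1 ?l" "coord2 (z - ?l) = coord2 z - coord2 ?l"
    using coord1_add[of "z - ?l" ?l] coord2_add[of "z - ?l" ?l] by simp_all
  then show "z - ?l \<in> period_box (1/2)"
    unfolding period_box_def XY using of_int_round_abs_le[of "coord1 z"] of_int_round_abs_le[of "coord2 z"]
    by (simp add: abs_minus_commute)
qed

lemma weighted_sigma_translate:
  assumes "l \<in> \<Lambda>"
  shows "weighted_sigma (z - l) = weighted_sigma z"
  using weighted_sigma_periodic[OF assms, of "z - l"] by simp

lemma weighted_sigma_bounded: "\<exists>C>0. \<forall>z. weighted_sigma z \<le> C"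
proof -
  have "bounded (weighted_sigma ` period_box (1/2))"
    by (intro compact_imp_bounded compact_continuous_image continuous_on_weighted_sigma compact_period_box)
  then obtain C where C: "C > 0" "\<And>z. z \<in> period_box (1/2) \<Longrightarrow> \<bar>weighted_sigma z\<bar> \<le> C"
    by (auto simp: bounded_pos)
  have "weighted_sigma z \<le> C" for z
  proof -
    obtain l where "l \<in> \<Lambda>" "z - l \<in> period_box (1/2)"
      using period_box_translate[of z] by blast
    with C(2) weighted_sigma_translate show ?thesis by (metis abs_le_D1)
  qed
  with C(1) show ?thesis by blast
qed

text \<open>
  The boundary lines of the translates of the central parallelogram. They stay away from the lattice,
  so on them \<open>\<bar>\<sigma>\<bar>\<close> attains its growth rate up to a constant factor.
\<close>
definition grid :: "complex set" where
  "grid = {z. coord1 z - 1/2 \<in> \<int> \<or> coord2 z - 1/2 \<in> \<int>}"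

lemma weighted_sigma_bounded_below_grid: "\<exists>c>0. \<forall>z\<in>grid. c \<le> weighted_sigma z"
proof -
  define K where "K = period_box (1/2) \<inter> {z. \<bar>coord1 z\<bar> = 1/2 \<or> \<bar>coord2 z\<bar> = 1/2}"
  have "closed {z. \<bar>coord1 z\<bar> = 1/2 \<or> \<bar>coord2 z\<bar> = 1/2}"
    by (intro closed_Collect_disj closed_Collect_eq continuous_intros)
  then have K: "compact K"
    unfolding K_def by (intro compact_Int_closed compact_period_box)
  have half: "1/2 \<notin> (\<int> :: real set)"
  proof
    assume "1/2 \<in> (\<int> :: real set)"
    then obtain k :: int where "1/2 = real_of_int k"
      by (auto elim: Ints_cases)
    then have "real_of_int (2 * k) = of_int 1" by simp
    then have "2 * k = 1" by (simp only: of_int_eq_iff)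
    then show False by presburger
  qed
  have reduce: "\<bar>x - of_int (round x)\<bar> = 1/2" if "x - 1/2 \<in> \<int>" for x :: real
  proof -
    from that obtain k :: int where "x = of_int k + 1/2"
      by (auto elim!: Ints_cases simp: algebra_simps)
    moreover have "round (of_int k + 1/2 :: real) = k + 1"
      by (simp add: round_def)
    ultimately show ?thesis by simp
  qed
  have grid: "\<exists>l\<in>\<Lambda>. z - l \<in> K" if "z \<in> grid" for z
  proof -
    obtain l where l: "l \<in> \<Lambda>" "z - l \<in> period_box (1/2)"
      "coord1 l = of_int (round (coord1 z))" "coord2 l = of_int (round (coord2 z))"
      using period_box_translate[of z] by blast
    have "coord1 (z - l) = coord1 z - coord1 l" "coord2 (z - l) = coord2 z - coord2 l"
      using coord1_add[of "z - l" l] coord2_add[of "z - l" l] by simp_all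
    with l that reduce show ?thesis
      unfolding K_def grid_def by auto
  qed
  have "of_real (1/2) * \<omega>1 + of_real 0 * \<omega>2 \<in> grid"
    unfolding grid_def mem_Collect_eq coord1_lattice by simp
  with grid have "K \<noteq> {}" by blast
  then obtain z0 where z0: "z0 \<in> K" "\<And>z. z \<in> K \<Longrightarrow> weighted_sigma z0 \<le> weighted_sigma z"
    using continuous_attains_inf[OF K _ continuous_on_weighted_sigma] by blast
  have "z0 \<notin> \<Lambda>"
  proof
    assume "z0 \<in> \<Lambda>"
    then have "\<bar>coord1 z0\<bar> \<in> \<int>" "\<bar>coord2 z0\<bar> \<in> \<int>"
      by (auto simp: mem_\<Lambda>_iff intro: Ints_abs)
    moreover have "\<bar>coord1 z0\<bar> = 1/2 \<or> \<bar>coord2 z0\<bar> = 1/2"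
      using z0(1) unfolding K_def by blast
    ultimately show False
      using half by metis
  qed
  then have "weighted_sigma z0 > 0"
    using sigma_eq_0_iff by (simp add: weighted_sigma_def)
  moreover have "weighted_sigma z0 \<le> weighted_sigma z" if "z \<in> grid" for z
    using grid[OF that] z0(2) weighted_sigma_translate by metis
  ultimately show ?thesis by blast
qed

section \<open>Cardinal functions for interpolation on the lattice\<close>

definition sigma_quotient :: "complex \<Rightarrow> complex" where
  "sigma_quotient z = (if z = 0 then 1 else \<sigma> z / (z * deriv \<sigma> 0))"

lemma holomorphic_sigma_quotient: "sigma_quotient holomorphic_on UNIV"
proof -
  have "(\<lambda>z. (if z = 0 then deriv \<sigma> 0 else (\<sigma> z - \<sigma> 0) / (z - 0)) / deriv \<sigma> 0)
      holomorphic_on UNIV"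
    by (intro holomorphic_intros pole_lemma_open holomorphic_sigma) (use deriv_sigma_0 in auto)
  then show ?thesis
    by (rule holomorphic_transform) (use deriv_sigma_0 in \<open>auto simp: sigma_quotient_def sigma_0\<close>)
qed

lemma sigma_quotient_bound: "\<exists>C>0. \<forall>z. cmod (sigma_quotient z) \<le> C * exp (\<beta> / 2 * (cmod z)\<^sup>2)"
proof -
  obtain C where C: "C > 0" "\<And>z. weighted_sigma z \<le> C"
    using weighted_sigma_bounded by blast
  have "bounded (sigma_quotient ` cball 0 1)"
    using holomorphic_on_imp_continuous_on[OF holomorphic_sigma_quotient]
    by (intro compact_imp_bounded compact_continuous_image) (auto intro: continuous_on_subset)
  then obtain D where D: "D > 0" "\<And>z. cmod z \<le> 1 \<Longrightarrow> cmod (sigma_quotient z) \<le> D"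
    by (auto simp: bounded_pos)
  define E where "E = max D (C / cmod (deriv \<sigma> 0))"
  have "cmod (sigma_quotient z) \<le> E * exp (\<beta> / 2 * (cmod z)\<^sup>2)" for z
  proof (cases "cmod z \<le> 1")
    case True
    have "cmod (sigma_quotient z) \<le> E * 1"
      using D(2)[OF True] by (simp add: E_def)
    also have "\<dots> \<le> E * exp (\<beta> / 2 * (cmod z)\<^sup>2)"
      using \<beta>_pos D(1) by (intro mult_left_mono) (auto simp: E_def)
    finally show ?thesis .
  next
    case False
    have "cmod (sigma_quotient z) = cmod (\<sigma> z) / (cmod z * cmod (deriv \<sigma> 0))"
      using False by (auto simp: sigma_quotient_def norm_divide norm_mult)
    also have "\<dots> \<le> cmod (\<sigma> z) / (1 * cmod (deriv \<sigma> 0))"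
      using False deriv_sigma_0
      by (intro divide_left_mono mult_right_mono mult_pos_pos) (auto simp: not_le intro: less_trans[of 0 1])
    also have "\<dots> = weighted_sigma z / cmod (deriv \<sigma> 0) * exp (\<beta> / 2 * (cmod z)\<^sup>2)"
      by (simp add: norm_sigma)
    also have "\<dots> \<le> E * exp (\<beta> / 2 * (cmod z)\<^sup>2)"
      using C(2)[of z] deriv_sigma_0
      by (intro mult_right_mono) (auto simp: E_def divide_right_mono le_max_iff_disj)
    finally show ?thesis .
  qed
  moreover have "E > 0" using D(1) by (simp add: E_def)
  ultimately show ?thesis by blast
qed

text \<open>
  The Weyl translate of \<open>sigma_quotient\<close> by \<open>l\<close>, normalised to have the value 1 at \<open>l\<close>. The exponential
  factor moves the Gaussian growth around \<open>l\<close> back to the origin, as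
  \<open>\<bar>z - l\<bar>\<^sup>2 + 2 Re (cnj l (z - l)) = \<bar>z\<bar>\<^sup>2 - \<bar>l\<bar>\<^sup>2\<close>.
\<close>
definition cardinal_fun :: "complex \<Rightarrow> complex \<Rightarrow> complex" where
  "cardinal_fun l z = sigma_quotient (z - l) * exp (of_real \<beta> * cnj l * (z - l))"

lemma holomorphic_cardinal_fun: "cardinal_fun l holomorphic_on UNIV"
proof -
  have "sigma_quotient \<circ> (\<lambda>z. z - l) holomorphic_on UNIV"
    by (rule holomorphic_on_compose_gen[OF _ holomorphic_sigma_quotient]) (auto intro!: holomorphic_intros)
  then show ?thesis
    unfolding cardinal_fun_def by (intro holomorphic_intros) (simp add: o_def)
qed

lemma cardinal_fun_self: "cardinal_fun l l = 1"
  by (simp add: cardinal_fun_def sigma_quotient_def)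

lemma cardinal_fun_lattice:
  assumes "l \<in> \<Lambda>" "l' \<in> \<Lambda>" "l \<noteq> l'"
  shows "cardinal_fun l l' = 0"
proof -
  have "weighted_sigma (l' - l) = weighted_sigma l'"
    by (rule weighted_sigma_translate[OF assms(1)])
  also have "\<dots> = 0"
    using assms(2) sigma_eq_0_iff by (simp add: weighted_sigma_def)
  finally show ?thesis
    using assms(3) by (simp add: cardinal_fun_def sigma_quotient_def weighted_sigma_def)
qed

text \<open>The separate Gaussian factor in \<open>l\<close> is what makes sums over the lattice converge uniformly.\<close>
lemma cardinal_fun_bound:
  "\<exists>C>0. \<forall>l z. cmod (cardinal_fun l z) \<le> C * exp (\<beta> / 2 * (cmod z)\<^sup>2) * exp (- \<beta> / 2 * (cmod l)\<^sup>2)"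
proof -
  obtain C where C: "C > 0" "\<And>z. cmod (sigma_quotient z) \<le> C * exp (\<beta> / 2 * (cmod z)\<^sup>2)"
    using sigma_quotient_bound by blast
  have "cmod (cardinal_fun l z) \<le> C * exp (\<beta> / 2 * (cmod z)\<^sup>2) * exp (- \<beta> / 2 * (cmod l)\<^sup>2)" for l z
  proof -
    have "\<beta> / 2 * (cmod (z - l))\<^sup>2 + \<beta> * Re (cnj l * (z - l)) = \<beta> / 2 * (cmod z)\<^sup>2 + - \<beta> / 2 * (cmod l)\<^sup>2"
      unfolding cmod_power2 by (simp add: power2_eq_square field_simps)
    then have e: "exp (\<beta> / 2 * (cmod (z - l))\<^sup>2) * exp (\<beta> * Re (cnj l * (z - l))) =
        exp (\<beta> / 2 * (cmod z)\<^sup>2) * exp (- \<beta> / 2 * (cmod l)\<^sup>2)"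
      by (simp only: exp_add[symmetric])
    have "Re (of_real \<beta> * cnj l * (z - l)) = \<beta> * Re (cnj l * (z - l))"
      by (simp add: algebra_simps)
    then have "cmod (cardinal_fun l z) = cmod (sigma_quotient (z - l)) * exp (\<beta> * Re (cnj l * (z - l)))"
      by (simp only: cardinal_fun_def norm_mult norm_exp_eq_Re)
    also have "\<dots> \<le> (C * exp (\<beta> / 2 * (cmod (z - l))\<^sup>2)) * exp (\<beta> * Re (cnj l * (z - l)))"
      by (intro mult_right_mono C) auto
    finally show ?thesis
      by (simp only: mult.assoc e)
  qed
  with C(1) show ?thesis by blast
qed

lemma norm_ge_coordinates: "\<exists>\<kappa>>0. \<forall>z. \<kappa> * ((coord1 z)\<^sup>2 + (coord2 z)\<^sup>2) \<le> (cmod z)\<^sup>2"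
proof -
  define D where "D = (cmod \<omega>1)\<^sup>2 + (cmod \<omega>2)\<^sup>2"
  have D: "D > 0" using \<omega>1_nz by (simp add: D_def add_pos_nonneg)
  have "area\<^sup>2 / D * ((coord1 z)\<^sup>2 + (coord2 z)\<^sup>2) \<le> (cmod z)\<^sup>2" for z
  proof -
    have "\<bar>Im (cnj z * \<omega>2)\<bar> \<le> cmod z * cmod \<omega>2" "\<bar>Im (cnj \<omega>1 * z)\<bar> \<le> cmod \<omega>1 * cmod z"
      by (rule order.trans[OF abs_Im_le_cmod], simp add: norm_mult)+
    then have "(Im (cnj z * \<omega>2))\<^sup>2 \<le> (cmod z * cmod \<omega>2)\<^sup>2" "(Im (cnj \<omega>1 * z))\<^sup>2 \<le> (cmod \<omega>1 * cmod z)\<^sup>2"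
      by (simp_all add: abs_le_square_iff[symmetric] abs_mult)
    moreover have "Im (cnj z * \<omega>2) = area * coord1 z" "Im (cnj \<omega>1 * z) = area * coord2 z"
      using area_pos by (simp_all add: coord1_def coord2_def)
    ultimately have "area\<^sup>2 * ((coord1 z)\<^sup>2 + (coord2 z)\<^sup>2) \<le> (cmod z)\<^sup>2 * D"
      by (simp add: D_def power_mult_distrib algebra_simps)
    then show ?thesis
      using D by (simp add: field_simps)
  qed
  moreover have "area\<^sup>2 / D > 0" using D area_pos by simp
  ultimately show ?thesis by blast
qed

definition lattice_point :: "int \<times> int \<Rightarrow> complex" where
  "lattice_point = (\<lambda>(m, n). of_real (of_int m) * \<omega>1 + of_real (of_int n) * \<omega>2)"

definition truncated_lattice :: "nat \<Rightarrow> complex set" where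
  "truncated_lattice N = lattice_point ` ({- int N..int N} \<times> {- int N..int N})"

lemma coord1_lattice_point [simp]: "coord1 (lattice_point p) = of_int (fst p)" and coord2_lattice_point [simp]: "coord2 (lattice_point p) = of_int (snd p)"
  unfolding lattice_point_def by (simp_all only: case_prod_beta coord1_lattice coord2_lattice)

lemma inj_lattice_point: "inj_on lattice_point A"
proof (rule inj_onI)
  fix p p' assume "lattice_point p = lattice_point p'"
  then have "coord1 (lattice_point p) = coord1 (lattice_point p')" "coord2 (lattice_point p) = coord2 (lattice_point p')" by simp_all
  then show "p = p'" by (simp add: prod_eq_iff)
qed

lemma finite_truncated_lattice: "finite (truncated_lattice N)"
  by (simp add: truncated_lattice_def)

lemma truncated_lattice_subset: "truncated_lattice N \<subseteq> \<Lambda>"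
  by (auto simp: truncated_lattice_def mem_\<Lambda>_iff)

lemma mem_truncated_latticeI:
  assumes "l \<in> \<Lambda>" "\<bar>coord1 l\<bar> < real N + 1" "\<bar>coord2 l\<bar> < real N + 1"
  shows "l \<in> truncated_lattice N"
proof -
  obtain m n :: int where mn: "coord1 l = of_int m" "coord2 l = of_int n"
    using assms(1) by (auto simp: mem_\<Lambda>_iff elim!: Ints_cases)
  have "l = lattice_point (m, n)"
    using lattice_coordinates[of l] by (simp add: lattice_point_def mn)
  moreover have "m \<in> {- int N..int N}" "n \<in> {- int N..int N}"
    using assms(2,3) unfolding mn by (simp_all, linarith+)
  ultimately show ?thesis
    unfolding truncated_lattice_def by blast
qed

text \<open>
  In lattice coordinates \<open>\<bar>l\<bar>\<^sup>2\<close> dominates \<open>m\<^sup>2 + n\<^sup>2\<close>, hence \<open>\<bar>m\<bar> + \<bar>n\<bar>\<close>, and the sum is dominated by a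
  product of two geometric sums.
\<close>
lemma gaussian_sum_bound: "\<exists>K>0. \<forall>N. (\<Sum>l\<in>truncated_lattice N. exp (- \<beta> / 2 * (cmod l)\<^sup>2)) \<le> K"
proof -
  obtain \<kappa> where \<kappa>: "\<kappa> > 0" "\<And>z. \<kappa> * ((coord1 z)\<^sup>2 + (coord2 z)\<^sup>2) \<le> (cmod z)\<^sup>2"
    using norm_ge_coordinates by blast
  define c where "c = \<beta> / 2 * \<kappa>"
  have c: "c > 0" using \<kappa> \<beta>_pos by (simp add: c_def)
  define f where "f m = exp (- (c * \<bar>real_of_int m\<bar>))" for m
  have summand_le: "exp (- \<beta> / 2 * (cmod (lattice_point p))\<^sup>2) \<le> f (fst p) * f (snd p)" for p
  proof -
    have sq: "\<bar>real_of_int m\<bar> \<le> (real_of_int m)\<^sup>2" for m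
    proof -
      have "\<bar>m\<bar> \<le> m\<^sup>2"
      proof (cases "m = 0")
        case False
        then have "\<bar>m\<bar> * 1 \<le> \<bar>m\<bar> * \<bar>m\<bar>"
          by (intro mult_left_mono) auto
        then show ?thesis by (simp add: power2_eq_square)
      qed simp
      then have "real_of_int \<bar>m\<bar> \<le> real_of_int (m\<^sup>2)"
        by (simp only: of_int_le_iff)
      then show ?thesis by simp
    qed
    have "c * \<bar>real_of_int (fst p)\<bar> + c * \<bar>real_of_int (snd p)\<bar>
        \<le> c * (real_of_int (fst p))\<^sup>2 + c * (real_of_int (snd p))\<^sup>2"
      using c by (intro add_mono mult_left_mono sq) auto
    also have "\<dots> = \<beta> / 2 * (\<kappa> * ((coord1 (lattice_point p))\<^sup>2 + (coord2 (lattice_point p))\<^sup>2))"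
      by (simp add: c_def algebra_simps)
    also have "\<dots> \<le> \<beta> / 2 * (cmod (lattice_point p))\<^sup>2"
      using \<beta>_pos by (intro mult_left_mono \<kappa>) auto
    finally show ?thesis
      by (simp add: f_def flip: exp_add)
  qed
  define K where "K = 2 / (1 - exp (- c))"
  have K: "K > 0" using c by (simp add: K_def)
  have "(\<Sum>l\<in>truncated_lattice N. exp (- \<beta> / 2 * (cmod l)\<^sup>2)) \<le> K * K" for N
  proof -
    let ?I = "{- int N..int N}"
    have "(\<Sum>l\<in>truncated_lattice N. exp (- \<beta> / 2 * (cmod l)\<^sup>2)) = (\<Sum>p\<in>?I \<times> ?I. exp (- \<beta> / 2 * (cmod (lattice_point p))\<^sup>2))"
      unfolding truncated_lattice_def by (subst sum.reindex[OF inj_lattice_point]) simp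
    also have "\<dots> \<le> (\<Sum>p\<in>?I \<times> ?I. f (fst p) * f (snd p))"
      by (intro sum_mono summand_le)
    also have "\<dots> = sum f ?I * sum f ?I"
      by (simp add: sum_product sum.cartesian_product case_prod_beta)
    also have "\<dots> \<le> K * K"
      unfolding K_def f_def using c
      by (intro mult_mono sum_exp_neg_abs_int_le sum_nonneg) auto
    finally show ?thesis .
  qed
  with K show ?thesis by (intro exI[of _ "K * K"]) simp
qed

section \<open>Subcritical growth and the interpolation estimate\<close>

text \<open>
  The linear term in the exponent is there to make the class invariant under translations: shifting the argument
  by \<open>w\<close> changes \<open>\<bar>z\<bar>\<^sup>2\<close> by \<open>O (\<bar>z\<bar>)\<close>.
\<close>
definition subcritical :: "(complex \<Rightarrow> complex) \<Rightarrow> bool" where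
  "subcritical F \<longleftrightarrow> F holomorphic_on UNIV \<and>
     (\<exists>a A B. a < \<beta> \<and> B \<ge> 0 \<and> (\<forall>z. cmod (F z) \<le> A * exp (a / 2 * (cmod z)\<^sup>2 + B * cmod z)))"

lemma subcritical_translate:
  assumes "subcritical F"
  shows "subcritical (\<lambda>z. F (z + w))"
proof -
  from assms obtain a A B where F: "F holomorphic_on UNIV" and a: "a < \<beta>" and B: "B \<ge> 0"
    and bound: "\<And>z. cmod (F z) \<le> A * exp (a / 2 * (cmod z)\<^sup>2 + B * cmod z)"
    unfolding subcritical_def by blast
  have "0 \<le> A * exp (a / 2 * (cmod 0)\<^sup>2 + B * cmod 0)"
    using bound[of 0] norm_ge_zero order.trans by blast
  then have A: "A \<ge> 0" by simp
  have "F \<circ> (\<lambda>z. z + w) holomorphic_on UNIV"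
    by (rule holomorphic_on_compose_gen[OF _ F]) (auto intro!: holomorphic_intros)
  then have hol: "(\<lambda>z. F (z + w)) holomorphic_on UNIV"
    by (simp add: o_def)
  \<comment> \<open>A negative rate \<open>a\<close> is replaced by 0 because \<open>\<bar>z + w\<bar>\<close> is only estimated from above.\<close>
  define b where "b = max a 0"
  have b: "b < \<beta>" "b \<ge> 0" "a \<le> b"
    using a \<beta>_pos by (auto simp: b_def)
  define A' where "A' = A * exp (b / 2 * (cmod w)\<^sup>2 + B * cmod w)"
  define B' where "B' = b * cmod w + B"
  have "cmod (F (z + w)) \<le> A' * exp (b / 2 * (cmod z)\<^sup>2 + B' * cmod z)" for z
  proof -
    have n: "cmod (z + w) \<le> cmod z + cmod w" by (rule norm_triangle_ineq)
    then have "(cmod (z + w))\<^sup>2 \<le> (cmod z + cmod w)\<^sup>2"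
      by (intro power_mono) auto
    with b have "a / 2 * (cmod (z + w))\<^sup>2 \<le> b / 2 * (cmod z + cmod w)\<^sup>2"
      by (intro mult_mono) auto
    moreover have "B * cmod (z + w) \<le> B * (cmod z + cmod w)"
      using n B by (intro mult_left_mono)
    ultimately have "a / 2 * (cmod (z + w))\<^sup>2 + B * cmod (z + w) \<le>
        b / 2 * (cmod z + cmod w)\<^sup>2 + B * (cmod z + cmod w)" by simp
    also have "\<dots> = (b / 2 * (cmod w)\<^sup>2 + B * cmod w) + (b / 2 * (cmod z)\<^sup>2 + B' * cmod z)"
      by (simp add: B'_def power2_eq_square field_simps)
    finally have "exp (a / 2 * (cmod (z + w))\<^sup>2 + B * cmod (z + w)) \<le>
        exp (b / 2 * (cmod w)\<^sup>2 + B * cmod w) * exp (b / 2 * (cmod z)\<^sup>2 + B' * cmod z)"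
      by (simp add: exp_add[symmetric])
    then have "A * exp (a / 2 * (cmod (z + w))\<^sup>2 + B * cmod (z + w)) \<le>
        A' * exp (b / 2 * (cmod z)\<^sup>2 + B' * cmod z)"
      unfolding A'_def mult.assoc using A by (intro mult_left_mono)
    with bound show ?thesis using order.trans by blast
  qed
  moreover have "B' \<ge> 0" using b B by (simp add: B'_def)
  ultimately show ?thesis
    unfolding subcritical_def using hol b by blast
qed

lemma subcritical_small:
  assumes "subcritical F" "\<delta> > 0"
  shows "\<exists>R. \<forall>z. cmod z \<ge> R \<longrightarrow> cmod (F z) \<le> \<delta> * exp (\<beta> / 2 * (cmod z)\<^sup>2)"
proof -
  from assms obtain a A B where a: "a < \<beta>"
    and bound: "\<And>z. cmod (F z) \<le> A * exp (a / 2 * (cmod z)\<^sup>2 + B * cmod z)"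
    unfolding subcritical_def by blast
  define d where "d = (\<beta> - a) / 2"
  have d: "d > 0" using a by (simp add: d_def)
  have "((\<lambda>t. A * exp (B * t - d * t\<^sup>2)) \<longlongrightarrow> 0) at_top"
    using d by real_asymp
  then have "eventually (\<lambda>t. A * exp (B * t - d * t\<^sup>2) < \<delta>) at_top"
    using assms(2) by (rule order_tendstoD)
  then obtain R where R: "\<And>t. t \<ge> R \<Longrightarrow> A * exp (B * t - d * t\<^sup>2) < \<delta>"
    by (auto simp: eventually_at_top_linorder)
  have "cmod (F z) \<le> \<delta> * exp (\<beta> / 2 * (cmod z)\<^sup>2)" if "cmod z \<ge> R" for z
  proof -
    have "a / 2 * (cmod z)\<^sup>2 + B * cmod z = (B * cmod z - d * (cmod z)\<^sup>2) + \<beta> / 2 * (cmod z)\<^sup>2"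
      by (simp add: d_def field_simps)
    then have "A * exp (a / 2 * (cmod z)\<^sup>2 + B * cmod z) =
        A * exp (B * cmod z - d * (cmod z)\<^sup>2) * exp (\<beta> / 2 * (cmod z)\<^sup>2)"
      by (simp only: exp_add mult.assoc)
    also have "\<dots> \<le> \<delta> * exp (\<beta> / 2 * (cmod z)\<^sup>2)"
      using R[OF that] by (intro mult_right_mono) auto
    finally show ?thesis using bound[of z] by simp
  qed
  then show ?thesis by blast
qed

lemma frontier_period_box: "frontier (period_box r) \<subseteq> {z \<in> period_box r. \<bar>coord1 z\<bar> = r \<or> \<bar>coord2 z\<bar> = r}"
proof
  fix z assume z: "z \<in> frontier (period_box r)"
  then have zb: "z \<in> period_box r"
    using closed_period_box frontier_subset_closed by blast
  have "\<not> (\<bar>coord1 z\<bar> < r \<and> \<bar>coord2 z\<bar> < r)"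
  proof
    assume z': "\<bar>coord1 z\<bar> < r \<and> \<bar>coord2 z\<bar> < r"
    have "open {z. \<bar>coord1 z\<bar> < r \<and> \<bar>coord2 z\<bar> < r}"
      by (intro open_Collect_conj open_Collect_less continuous_intros)
    moreover have "{z. \<bar>coord1 z\<bar> < r \<and> \<bar>coord2 z\<bar> < r} \<subseteq> period_box r"
      by (auto simp: period_box_def)
    ultimately have "z \<in> interior (period_box r)"
      using z' by (intro interiorI) auto
    with z show False by (simp add: frontier_def)
  qed
  with zb show "z \<in> {z \<in> period_box r. \<bar>coord1 z\<bar> = r \<or> \<bar>coord2 z\<bar> = r}"
    by (auto simp: period_box_def)
qed

text \<open>
  The point of the estimate is that \<open>C\<close> does not depend on \<open>F\<close>, not even through its growth constants. Those
  only influence how large a parallelogram \<open>period_box r\<close> has to be chosen to make the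
  contribution of \<open>F\<close> on its boundary smaller than a given \<open>\<delta>\<close>. On that boundary
  \<open>\<bar>\<sigma>\<bar> \<ge> c exp (\<beta> \<bar>z\<bar>\<^sup>2 / 2)\<close>, so the quotient \<open>h = (F - I) / \<sigma>\<close>, with \<open>I\<close> the interpolation sum, is
  bounded there by \<open>(\<delta> + M Cp K) / c\<close>, where \<open>M Cp K\<close> comes from the bound of \<open>I\<close>. The maximum principle carries the bound of \<open>h\<close>
  to the central parallelogram, and \<open>\<delta>\<close> tends to 0.
\<close>
lemma interpolation_estimate:
  obtains C where "\<And>F M z. subcritical F \<Longrightarrow> (\<And>l. l \<in> \<Lambda> \<Longrightarrow> cmod (F l) \<le> M) \<Longrightarrow>
    z \<in> period_box (1/2) \<Longrightarrow> cmod (F z) \<le> C * M"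
proof -
  let ?E = "\<lambda>z. exp (\<beta> / 2 * (cmod z)\<^sup>2)"
  obtain c where c: "c > 0" "\<And>z. z \<in> grid \<Longrightarrow> c \<le> weighted_sigma z"
    using weighted_sigma_bounded_below_grid by blast
  obtain Cu where Cu: "Cu > 0" "\<And>z. weighted_sigma z \<le> Cu"
    using weighted_sigma_bounded by blast
  obtain Cp where Cp: "Cp > 0" "\<And>l z. cmod (cardinal_fun l z) \<le> Cp * ?E z * exp (- \<beta> / 2 * (cmod l)\<^sup>2)"
    using cardinal_fun_bound by blast
  obtain K where K: "K > 0" "\<And>N. (\<Sum>l\<in>truncated_lattice N. exp (- \<beta> / 2 * (cmod l)\<^sup>2)) \<le> K"
    using gaussian_sum_bound by blast
  obtain \<kappa> where \<kappa>: "\<kappa> > 0" "\<And>z. \<kappa> * ((coord1 z)\<^sup>2 + (coord2 z)\<^sup>2) \<le> (cmod z)\<^sup>2"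
    using norm_ge_coordinates by blast
  have "bounded (?E ` period_box (1/2))"
    by (intro compact_imp_bounded compact_continuous_image compact_period_box continuous_intros)
  then obtain CE where CE: "CE > 0" "\<And>z. z \<in> period_box (1/2) \<Longrightarrow> ?E z \<le> CE"
    by (force simp: bounded_pos)
  \<comment> \<open>The summand 1 accounts for the interpolation sum itself, and \<open>Cu / c\<close> for the loss in
    dividing by \<open>\<sigma>\<close> on the boundary and multiplying by it in the centre.\<close>
  define C where "C = CE * (Cu / c + 1) * (Cp * K)"
  have "cmod (F z) \<le> C * M"
    if F: "subcritical F" and M: "\<And>l. l \<in> \<Lambda> \<Longrightarrow> cmod (F l) \<le> M" and z: "z \<in> period_box (1/2)" for F M z
  proof -
    have F_hol: "F holomorphic_on UNIV" using F by (simp add: subcritical_def)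
    have M0: "M \<ge> 0" using M[OF zero_in_\<Lambda>] norm_ge_zero order.trans by blast
    have approx: "cmod (F z) \<le> C * M + (CE * Cu / c) * \<delta>" if \<delta>: "\<delta> > 0" for \<delta>
    proof -
      obtain R where R: "\<And>w. cmod w \<ge> R \<Longrightarrow> cmod (F w) \<le> \<delta> * ?E w"
        using subcritical_small[OF F \<delta>] by blast
      obtain N :: nat where N: "R\<^sup>2 / \<kappa> < real N"
        using reals_Archimedean2 by blast
      \<comment> \<open>Half-integral size puts the boundary on the grid; the open set \<open>A\<close> is slightly larger but
        contains the same lattice points, so that \<open>h\<close> is holomorphic across the boundary.\<close>
      define r where "r = real N + 1/2"
      define I where "I w = (\<Sum>l\<in>truncated_lattice N. F l * cardinal_fun l w)" for w
      define f where "f w = F w - I w" for w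
      define A where "A = {w. \<bar>coord1 w\<bar> < real N + 1 \<and> \<bar>coord2 w\<bar> < real N + 1}"
      have A_open: "open A"
        unfolding A_def by (intro open_Collect_conj open_Collect_less continuous_intros)
      have box_A: "period_box r \<subseteq> A"
        by (auto simp: period_box_def A_def r_def)
      have f_hol: "f holomorphic_on UNIV"
        unfolding f_def I_def by (intro holomorphic_intros F_hol holomorphic_cardinal_fun)
      have I_bound: "cmod (I w) \<le> M * Cp * K * ?E w" for w
      proof -
        have "cmod (I w) \<le> (\<Sum>l\<in>truncated_lattice N. M * (Cp * ?E w * exp (- \<beta> / 2 * (cmod l)\<^sup>2)))"
          unfolding I_def
        proof (rule sum_norm_le)
          fix l assume "l \<in> truncated_lattice N"
          then have "cmod (F l) \<le> M" using M truncated_lattice_subset by blast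
          then show "cmod (F l * cardinal_fun l w) \<le> M * (Cp * ?E w * exp (- \<beta> / 2 * (cmod l)\<^sup>2))"
            unfolding norm_mult by (intro mult_mono Cp) (use M0 in auto)
        qed
        also have "\<dots> = M * Cp * ?E w * (\<Sum>l\<in>truncated_lattice N. exp (- \<beta> / 2 * (cmod l)\<^sup>2))"
          by (simp add: sum_distrib_left mult.assoc)
        also have "\<dots> \<le> M * Cp * ?E w * K"
          using M0 Cp(1) by (intro mult_left_mono K) auto
        finally show ?thesis by (simp add: mult_ac)
      qed
      have f_lattice: "f l = 0" if "l \<in> truncated_lattice N" for l
      proof -
        have "I l = (\<Sum>l'\<in>truncated_lattice N. if l' = l then F l else 0)"
          unfolding I_def
          by (rule sum.cong) (use that truncated_lattice_subset[of N] in \<open>auto simp: cardinal_fun_self intro!: cardinal_fun_lattice\<close>)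
        then show ?thesis
          using that finite_truncated_lattice by (simp add: f_def)
      qed
      have zeros: "f w = 0 \<and> deriv \<sigma> w \<noteq> 0" if "w \<in> A" "\<sigma> w = 0" for w
      proof -
        have "w \<in> \<Lambda>" using that sigma_eq_0_iff by simp
        with that show ?thesis
          using f_lattice mem_truncated_latticeI deriv_sigma_nz by (auto simp: A_def)
      qed
      define h where "h = (\<lambda>w. if \<sigma> w = 0 then deriv f w / deriv \<sigma> w else f w / \<sigma> w)"
      have h_hol: "h holomorphic_on A"
        unfolding h_def
        by (rule holomorphic_divide_simple_zeros[OF A_open])
           (auto intro: holomorphic_on_subset[OF f_hol] holomorphic_on_subset[OF holomorphic_sigma] dest: zeros)
      have h_eq: "f w = \<sigma> w * h w" if "w \<in> A" for w
        using zeros[OF that] by (auto simp: h_def)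
      have h_bound: "cmod (h z) \<le> (\<delta> + M * Cp * K) / c"
      proof (rule maximum_modulus_frontier[where f = h and S = "period_box r" and \<xi> = z])
        show "h holomorphic_on interior (period_box r)"
          using h_hol box_A interior_subset holomorphic_on_subset by blast
        show "continuous_on (closure (period_box r)) h"
          using h_hol box_A closed_period_box
          by (auto intro: holomorphic_on_imp_continuous_on continuous_on_subset)
        show "bounded (period_box r)"
          by (intro compact_imp_bounded compact_period_box)
        show "z \<in> period_box r"
          using z by (auto simp: period_box_def r_def)
        fix w assume "w \<in> frontier (period_box r)"
        then have w: "w \<in> period_box r" "\<bar>coord1 w\<bar> = r \<or> \<bar>coord2 w\<bar> = r"
          using frontier_period_box by auto
        have half: "x - 1/2 \<in> \<int>" if "\<bar>x\<bar> = r" for x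
        proof -
          have "x - 1/2 = of_int (int N) \<or> x - 1/2 = of_int (- int N - 1)"
            using that by (auto simp: r_def abs_if split: if_splits)
          then show ?thesis by (metis Ints_of_int)
        qed
        have "w \<in> grid"
          using w(2) half by (auto simp: grid_def)
        then have cu: "c \<le> weighted_sigma w" by (rule c)
        have "real N \<le> r * r"
          unfolding r_def by (simp add: algebra_simps)
        also have "r * r \<le> (coord1 w)\<^sup>2 + (coord2 w)\<^sup>2"
          using w(2) by (metis abs_mult_self_eq add_increasing add_increasing2 order_refl power2_eq_square zero_le_power2)
        finally have "\<kappa> * real N \<le> (cmod w)\<^sup>2"
          using \<kappa>(1) by (intro order.trans[OF mult_left_mono \<kappa>(2)]) auto
        moreover have "R\<^sup>2 \<le> \<kappa> * real N"
          using N \<kappa>(1) by (simp add: field_simps)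
        ultimately have "R \<le> cmod w"
          using power2_le_imp_le[of R "cmod w"] by simp
        then have "cmod (f w) \<le> \<delta> * ?E w + M * Cp * K * ?E w"
          unfolding f_def using R I_bound[of w] norm_triangle_ineq4[of "F w" "I w"] by fastforce
        then have "cmod (f w) \<le> (\<delta> + M * Cp * K) * ?E w"
          by (simp add: distrib_right)
        moreover have "cmod (f w) = weighted_sigma w * ?E w * cmod (h w)"
          using h_eq[of w] w(1) box_A by (auto simp: norm_mult norm_sigma)
        ultimately have "?E w * (weighted_sigma w * cmod (h w)) \<le> ?E w * (\<delta> + M * Cp * K)"
          by (simp add: mult_ac)
        then have "weighted_sigma w * cmod (h w) \<le> \<delta> + M * Cp * K"
          by simp
        moreover have "c * cmod (h w) \<le> weighted_sigma w * cmod (h w)"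
          using cu by (intro mult_right_mono) auto
        ultimately show "cmod (h w) \<le> (\<delta> + M * Cp * K) / c"
          using c(1) by (simp add: field_simps)
      qed
      have "z \<in> A" using z by (auto simp: period_box_def A_def)
      then have "cmod (f z) = weighted_sigma z * ?E z * cmod (h z)"
        using h_eq by (simp add: norm_mult norm_sigma)
      also have "\<dots> \<le> Cu * CE * ((\<delta> + M * Cp * K) / c)"
        using Cu CE z h_bound by (intro mult_mono) (auto simp: weighted_sigma_def)
      finally have "cmod (f z) \<le> Cu * CE * ((\<delta> + M * Cp * K) / c)" .
      moreover have "cmod (I z) \<le> M * Cp * K * CE"
        using M0 Cp(1) K(1) CE(2)[OF z] by (intro order.trans[OF I_bound] mult_left_mono) auto
      moreover have "cmod (F z) \<le> cmod (f z) + cmod (I z)"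
        using norm_triangle_ineq[of "f z" "I z"] by (simp add: f_def)
      ultimately have "cmod (F z) \<le> Cu * CE * ((\<delta> + M * Cp * K) / c) + M * Cp * K * CE"
        by simp
      also have "\<dots> = C * M + (CE * Cu / c) * \<delta>"
        using c(1) by (simp add: C_def field_simps)
      finally show ?thesis .
    qed
    define B where "B = CE * Cu / c"
    have B: "B > 0" using CE Cu c by (simp add: B_def)
    show ?thesis
    proof (rule field_le_epsilon)
      fix e :: real assume "e > 0"
      then show "cmod (F z) \<le> C * M + e"
        using approx[of "e / B"] B by (simp flip: B_def)
    qed
  qed
  then show thesis by (rule that)
qed

text \<open>
  A lattice translate of \<open>F\<close> takes the same values on the lattice up to a permutation, so one bound from
  the interpolation estimate holds on all translates of the central parallelogram.
\<close>
lemma subcritical_bounded_on_lattice_imp_constant: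
  assumes "subcritical F" "bounded (F ` \<Lambda>)"
  shows "F constant_on UNIV"
proof -
  obtain M where M: "\<And>l. l \<in> \<Lambda> \<Longrightarrow> cmod (F l) \<le> M"
    using assms(2) by (auto simp: bounded_iff)
  obtain C where C: "\<And>F M z. subcritical F \<Longrightarrow> (\<And>l. l \<in> \<Lambda> \<Longrightarrow> cmod (F l) \<le> M) \<Longrightarrow>
    z \<in> period_box (1/2) \<Longrightarrow> cmod (F z) \<le> C * M"
    using interpolation_estimate by blast
  have "cmod (F z) \<le> C * M" for z
  proof -
    obtain l where l: "l \<in> \<Lambda>" "z - l \<in> period_box (1/2)"
      using period_box_translate[of z] by blast
    have "cmod (F (z - l + l)) \<le> C * M"
      using C[OF subcritical_translate[OF assms(1), of l] _ l(2)] M \<Lambda>_add[OF _ l(1)] by simp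
    then show ?thesis by simp
  qed
  then have "bounded (range F)"
    by (auto simp: bounded_iff)
  then show ?thesis
    using assms(1) by (intro Liouville_theorem) (auto simp: subcritical_def)
qed

section \<open>The two sides of the critical area\<close>

text \<open>
  The function is \<open>\<sigma> z / (z (z - \<omega>1))\<close> up to a constant. Its modulus is at most a multiple of
  \<open>exp (\<beta> \<bar>z\<bar>\<^sup>2 / 2) / (1 + \<bar>z\<bar>\<^sup>2)\<close>: away from both removed zeros by boundedness of the weighted
  modulus of \<open>\<sigma>\<close>, and near them by compactness.
\<close>
lemma Fock_function_vanishing_off_two_points:
  assumes "\<beta> \<le> \<alpha>"
  obtains F where "F \<in> Fock_space \<alpha>" "F 0 \<noteq> 0" "\<And>l. l \<in> \<Lambda> \<Longrightarrow> l \<noteq> 0 \<Longrightarrow> l \<noteq> \<omega>1 \<Longrightarrow> F l = 0"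
proof -
  have g_zero: "sigma_quotient l = 0" if "l \<in> \<Lambda>" "l \<noteq> 0" for l
    using that sigma_eq_0_iff by (simp add: sigma_quotient_def)
  define F where "F = (\<lambda>z. if z = \<omega>1 then deriv sigma_quotient \<omega>1 else (sigma_quotient z - sigma_quotient \<omega>1) / (z - \<omega>1))"
  have hol: "F holomorphic_on UNIV"
    unfolding F_def by (intro pole_lemma_open holomorphic_sigma_quotient) auto
  have F_eq: "F z = sigma_quotient z / (z - \<omega>1)" if "z \<noteq> \<omega>1" for z
    using that g_zero[OF \<omega>1_in_\<Lambda> \<omega>1_nz] by (simp add: F_def)
  have F0: "F 0 \<noteq> 0"
    using F_eq[of 0] \<omega>1_nz by (simp add: sigma_quotient_def)
  have F_lat: "F l = 0" if "l \<in> \<Lambda>" "l \<noteq> 0" "l \<noteq> \<omega>1" for l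
    using that by (simp add: F_eq g_zero)
  obtain Cu where Cu: "Cu > 0" "\<And>z. weighted_sigma z \<le> Cu"
    using weighted_sigma_bounded by blast
  \<comment> \<open>Outside the disc of radius \<open>R\<close> one has \<open>\<bar>z - \<omega>1\<bar> \<ge> \<bar>z\<bar> / 2\<close> and \<open>\<bar>z\<bar> \<ge> 1\<close>.\<close>
  define R where "R = 2 * cmod \<omega>1 + 1"
  have "bounded (F ` cball 0 R)"
    using holomorphic_on_imp_continuous_on[OF hol]
    by (intro compact_imp_bounded compact_continuous_image) (auto intro: continuous_on_subset)
  then obtain D where D: "D > 0" "\<And>z. cmod z \<le> R \<Longrightarrow> cmod (F z) \<le> D"
    by (auto simp: bounded_pos)
  define C where "C = max (D * (1 + R\<^sup>2)) (4 * Cu / cmod (deriv \<sigma> 0))"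
  have C: "C > 0" "D * (1 + R\<^sup>2) \<le> C" "4 * Cu / cmod (deriv \<sigma> 0) \<le> C"
    using D(1) by (auto simp: C_def less_max_iff_disj add_pos_nonneg)
  have bound: "cmod (F z) * (1 + (cmod z)\<^sup>2) \<le> C * exp (\<beta> / 2 * (cmod z)\<^sup>2)" for z
  proof (cases "cmod z \<le> R")
    case True
    then have "(cmod z)\<^sup>2 \<le> R\<^sup>2"
      by (intro power_mono) auto
    then have "cmod (F z) * (1 + (cmod z)\<^sup>2) \<le> D * (1 + R\<^sup>2)"
      using D True by (intro mult_mono) auto
    also have "\<dots> \<le> C * 1" using C by simp
    also have "\<dots> \<le> C * exp (\<beta> / 2 * (cmod z)\<^sup>2)"
      using C \<beta>_pos by (intro mult_left_mono) auto
    finally show ?thesis .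
  next
    case False
    then have z: "cmod z > 2 * cmod \<omega>1 + 1" by (simp add: R_def)
    then have z1: "cmod z \<ge> 1" "z \<noteq> 0" "z \<noteq> \<omega>1"
      using norm_ge_zero[of \<omega>1] by (auto simp del: norm_ge_zero)
    have "cmod z / 2 \<le> cmod (z - \<omega>1)"
      using norm_triangle_ineq2[of z \<omega>1] z by simp
    then have "cmod z * (cmod z / 2) \<le> cmod z * cmod (z - \<omega>1)"
      by (intro mult_left_mono) auto
    moreover have "1 \<le> (cmod z)\<^sup>2"
      using z1 by (simp add: one_le_power)
    ultimately have dec: "1 + (cmod z)\<^sup>2 \<le> 4 * (cmod z * cmod (z - \<omega>1))"
      by (simp add: power2_eq_square)
    have "cmod (F z) = cmod (\<sigma> z) / cmod (deriv \<sigma> 0) / (cmod z * cmod (z - \<omega>1))"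
      using z1 by (simp add: F_eq sigma_quotient_def norm_divide norm_mult)
    then have "cmod (F z) * (cmod z * cmod (z - \<omega>1)) = cmod (\<sigma> z) / cmod (deriv \<sigma> 0)"
      using z1 by simp
    moreover have "cmod (F z) * (1 + (cmod z)\<^sup>2) \<le> cmod (F z) * (4 * (cmod z * cmod (z - \<omega>1)))"
      using dec by (intro mult_left_mono) auto
    ultimately have "cmod (F z) * (1 + (cmod z)\<^sup>2) \<le> 4 * weighted_sigma z / cmod (deriv \<sigma> 0) * exp (\<beta> / 2 * (cmod z)\<^sup>2)"
      by (simp add: norm_sigma)
    also have "\<dots> \<le> C * exp (\<beta> / 2 * (cmod z)\<^sup>2)"
    proof (intro mult_right_mono)
      have "4 * weighted_sigma z / cmod (deriv \<sigma> 0) \<le> 4 * Cu / cmod (deriv \<sigma> 0)"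
        using Cu(2) by (intro divide_right_mono mult_left_mono) auto
      with C(3) show "4 * weighted_sigma z / cmod (deriv \<sigma> 0) \<le> C" by simp
    qed auto
    finally show ?thesis .
  qed
  have "integrable lborel (\<lambda>z. (cmod (F z))\<^sup>2 * exp (- \<alpha> * (cmod z)\<^sup>2))"
  proof (rule Bochner_Integration.integrable_bound)
    show "integrable lborel (\<lambda>z::complex. C\<^sup>2 * (1 / (1 + (cmod z)\<^sup>2)\<^sup>2))"
      by (intro integrable_mult_right integrable_quartic_decay)
    note [measurable] = measurable_entire[OF hol]
    show "(\<lambda>z. (cmod (F z))\<^sup>2 * exp (- \<alpha> * (cmod z)\<^sup>2)) \<in> borel_measurable lborel"
      by measurable
    show "AE z in lborel. norm ((cmod (F z))\<^sup>2 * exp (- \<alpha> * (cmod z)\<^sup>2)) \<le>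
        norm (C\<^sup>2 * (1 / (1 + (cmod z)\<^sup>2)\<^sup>2))"
    proof (rule AE_I2)
      fix z :: complex
      let ?s = "1 + (cmod z)\<^sup>2"
      have s: "?s > 0" by (simp add: add_pos_nonneg)
      have "(cmod (F z) * ?s)\<^sup>2 \<le> (C * exp (\<beta> / 2 * (cmod z)\<^sup>2))\<^sup>2"
        using bound[of z] s by (intro power_mono) auto
      then have "(cmod (F z))\<^sup>2 * ?s\<^sup>2 \<le> C\<^sup>2 * exp (\<beta> * (cmod z)\<^sup>2)"
        by (simp add: power_mult_distrib flip: exp_double)
      then have "(cmod (F z))\<^sup>2 * ?s\<^sup>2 * exp (- \<alpha> * (cmod z)\<^sup>2) \<le>
          C\<^sup>2 * exp (\<beta> * (cmod z)\<^sup>2) * exp (- \<alpha> * (cmod z)\<^sup>2)"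
        by (intro mult_right_mono) auto
      also have "\<dots> = C\<^sup>2 * exp ((\<beta> - \<alpha>) * (cmod z)\<^sup>2)"
        by (simp add: algebra_simps flip: exp_add)
      also have "\<dots> \<le> C\<^sup>2 * 1"
        using assms by (intro mult_left_mono) (auto simp: mult_nonpos_nonneg)
      finally have "(cmod (F z))\<^sup>2 * exp (- \<alpha> * (cmod z)\<^sup>2) \<le> C\<^sup>2 * (1 / ?s\<^sup>2)"
        using s by (simp add: field_simps)
      then show "norm ((cmod (F z))\<^sup>2 * exp (- \<alpha> * (cmod z)\<^sup>2)) \<le> norm (C\<^sup>2 * (1 / ?s\<^sup>2))"
        by simp
    qed
  qed
  with hol have "F \<in> Fock_space \<alpha>"
    by (simp add: Fock_space_def)
  from this F0 F_lat show thesis by (rule that)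
qed

lemma not_Liouville_set_if_ge:
  assumes "\<beta> \<le> \<alpha>"
  shows "\<not> Liouville_set \<alpha> \<Lambda>"
proof
  assume L: "Liouville_set \<alpha> \<Lambda>"
  obtain F where F: "F \<in> Fock_space \<alpha>" "F 0 \<noteq> 0"
    "\<And>l. l \<in> \<Lambda> \<Longrightarrow> l \<noteq> 0 \<Longrightarrow> l \<noteq> \<omega>1 \<Longrightarrow> F l = 0"
    using Fock_function_vanishing_off_two_points[OF assms] by blast
  have sub: "F ` \<Lambda> \<subseteq> {0, F 0, F \<omega>1}"
    using F(3) by blast
  have "bounded (F ` \<Lambda>)"
    by (rule bounded_subset[OF _ sub]) simp
  with L F(1) have "F constant_on UNIV"
    by (simp add: Liouville_set_def)
  moreover have "F (\<omega>1 + \<omega>1) = 0"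
    using \<Lambda>_add[OF \<omega>1_in_\<Lambda> \<omega>1_in_\<Lambda>] \<omega>1_nz by (intro F(3)) (auto simp flip: mult_2)
  ultimately show False
    using F(2) by (metis UNIV_I constant_on_def)
qed

lemma Liouville_set_if_lt:
  assumes "0 < \<alpha>" "\<alpha> < \<beta>"
  shows "Liouville_set \<alpha> \<Lambda>"
  unfolding Liouville_set_def
proof (intro ballI impI)
  fix F assume F: "F \<in> Fock_space \<alpha>" and bd: "bounded (F ` \<Lambda>)"
  obtain A where "\<And>z. cmod (F z) \<le> A * exp (\<alpha> / 2 * (cmod z)\<^sup>2 + \<alpha> * cmod z)"
    using Fock_space_pointwise_bound[OF F assms(1)] by blast
  then have "\<exists>a A B. a < \<beta> \<and> B \<ge> 0 \<and> (\<forall>z. cmod (F z) \<le> A * exp (a / 2 * (cmod z)\<^sup>2 + B * cmod z))"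
    using assms by (intro exI[of _ \<alpha>] exI[of _ A] exI[of _ \<alpha>]) auto
  then have "subcritical F"
    using F by (simp add: subcritical_def Fock_space_def)
  then show "F constant_on UNIV"
    using bd by (rule subcritical_bounded_on_lattice_imp_constant)
qed

end

theorem theorem2p6:
  fixes \<alpha> :: real and \<omega>1 \<omega>2 :: complex
  assumes "\<alpha> > 0" and "lattice_periods \<omega>1 \<omega>2"
  shows "Liouville_set \<alpha> (period_lattice \<omega>1 \<omega>2) \<longleftrightarrow> lattice_area \<omega>1 \<omega>2 < pi / \<alpha>"
proof -
  interpret period_pair \<omega>1 \<omega>2
    by unfold_locales (rule assms(2))
  have "\<alpha> < \<beta> \<longleftrightarrow> area < pi / \<alpha>"
    using assms(1) area_pos by (simp add: \<beta>_def field_simps)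
  moreover have "Liouville_set \<alpha> \<Lambda> \<longleftrightarrow> \<alpha> < \<beta>"
    using Liouville_set_if_lt[OF assms(1)] not_Liouville_set_if_ge
    by (metis not_le)
  ultimately show ?thesis
    by (simp add: area_def \<Lambda>_def)
qed

end
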